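(* For all integers $n\ge 2$, \[ b(n,2)=p(n,2)=3E(n-1,2)-2\binom{n}{3}+\binom{n}{2}-1. \]
   Context: For a permutation $\pi=\pi_1\cdots\pi_n\in S_n$, a position $i\in\{1,\dots,n-1\}$ is an ascent if $\pi_i<\pi_{i+1}$ and a descent if $\pi_i>\pi_{i+1}$. The permutation $\pi$ is called ballot if for every $1\le k\le n-1$, the number of ascents among positions $1,\dots,k$ is at least the number of descents among positions $1,\dots,k$. Let $b(n,d)$ be the number of ballot permutations in $S_n$ with exactly $d$ descents. For a cycle $\mathfrak c=(c_1,\dots,c_k)$ of a permutation (fixed points are cycles of length 1), let $\mathrm{cA}(\mathfrak c)$ be the number of $i\in\{1,\dots,k\}$ with $c_i\le c_{i+1}$ and $\mathrm{cD}(\mathfrak c)$ the number with $c_i>c_{i+1}$, where $c_{k+1}=c_1$; let $M(\mathfrak c)=\min(\mathrm{cA}(\mathfrak c),\mathrm{cD}(\mathfrak c))$, and for a permutation $\pi$ let $M(\pi)$ be the sum of $M$ over its cycles. Let $p(n,d)$ be the number of permutations in $S_n$ all of whose cycles have odd length and with $M(\pi)=d$. $E(n,d)$ denotes the Eulerian number: the number of permutations of $[n]$ with exactly $d$ descents, with $E(0,0)=1$ and $E(0,d)=0$ for $d\ge1$. *)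

theory Defs
  imports "HOL-Combinatorics.Cycles"
begin

definition ascents :: "nat \<Rightarrow> (nat \<Rightarrow> nat) \<Rightarrow> nat set" where
  "ascents n \<pi> = {i \<in> {1..<n}. \<pi> i < \<pi> (i + 1)}"

definition descents :: "nat \<Rightarrow> (nat \<Rightarrow> nat) \<Rightarrow> nat set" where
  "descents n \<pi> = {i \<in> {1..<n}. \<pi> i > \<pi> (i + 1)}"

definition ballot :: "nat \<Rightarrow> (nat \<Rightarrow> nat) \<Rightarrow> bool" where
  "ballot n \<pi> \<longleftrightarrow>
     (\<forall>k\<in>{1..<n}. card (ascents n \<pi> \<inter> {1..k}) \<ge> card (descents n \<pi> \<inter> {1..k}))"

definition ballot_number :: "nat \<Rightarrow> nat \<Rightarrow> nat" where
  "ballot_number n d =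
     card {\<pi>. \<pi> permutes {1..n} \<and> ballot n \<pi> \<and> card (descents n \<pi>) = d}"

text \<open>A cycle \<open>(c\<^sub>1, \<dots>, c\<^sub>k)\<close> is the list \<open>[c\<^sub>1, \<dots>, c\<^sub>k]\<close>; list indices start
  at \<open>0\<close> and are read modulo the length, which implements \<open>c\<^bsub>k+1\<^esub> = c\<^sub>1\<close>.\<close>

definition cA :: "nat list \<Rightarrow> nat" where
  "cA c = card {i \<in> {..<length c}. c ! i \<le> c ! (Suc i mod length c)}"

definition cD :: "nat list \<Rightarrow> nat" where
  "cD c = card {i \<in> {..<length c}. c ! i > c ! (Suc i mod length c)}"

definition cycle_M :: "nat list \<Rightarrow> nat" where
  "cycle_M c = min (cA c) (cD c)"

text \<open>The list \<open>support \<pi> x\<close> is \<open>[x, \<pi> x, \<pi> (\<pi> x), \<dots>]\<close> up to the first return to \<open>x\<close>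
  (so \<open>[x]\<close> for a fixed point). Each cycle is represented once, by the rotation that
  starts with its least element.\<close>

definition perm_cycles :: "nat \<Rightarrow> (nat \<Rightarrow> nat) \<Rightarrow> nat list set" where
  "perm_cycles n \<pi> = {support \<pi> x | x. x \<in> {1..n} \<and> (\<forall>y \<in> set (support \<pi> x). x \<le> y)}"

definition perm_M :: "nat \<Rightarrow> (nat \<Rightarrow> nat) \<Rightarrow> nat" where
  "perm_M n \<pi> = (\<Sum>c\<in>perm_cycles n \<pi>. cycle_M c)"

definition odd_cycle_number :: "nat \<Rightarrow> nat \<Rightarrow> nat" where
  "odd_cycle_number n d =
     card {\<pi>. \<pi> permutes {1..n} \<and> (\<forall>c\<in>perm_cycles n \<pi>. odd (length c)) \<and> perm_M n \<pi> = d}"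

definition eulerian :: "nat \<Rightarrow> nat \<Rightarrow> nat" where
  "eulerian n d = card {\<pi>. \<pi> permutes {1..n} \<and> card (descents n \<pi>) = d}"

lemma eulerian_0: "eulerian 0 d = (if d = 0 then 1 else 0)"
  by (simp add: eulerian_def descents_def)

end

theory Submission
  imports Defs "HOL-Combinatorics.Multiset_Permutations"
begin

text \<open>Both sides are counted through ordered splittings of an interval of integers into three
  increasing lists \<open>(a, b, c)\<close>. A permutation with two descents is \<open>a @ b @ c\<close>, cut at its
  descents; it is ballot unless \<open>length a = 1\<close>, or \<open>length a = 2\<close> and \<open>length b = 1\<close>.
  A permutation with odd cycles and \<open>M = 2\<close> has, apart from fixed points (collected in \<open>c\<close>),
  either one cycle with two cyclic descents or two cyclic ascents, or two cycles with one cyclic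
  descent or ascent each. Up to reversal the former is \<open>a @ b\<close> and the latter are \<open>a\<close> and \<open>b\<close>,
  which gives factors 2 and 4. Deciding which list contains the least element yields linear
  recurrences for all these counts, hence closed forms.\<close>

section \<open>Splitting an interval into three increasing lists\<close>

text \<open>No bijection between the two families of permutations is constructed; they are matched
  only through closed forms in 3^n, 2^n, (-1)^n and polynomials. The term (-1)^n comes from the
  parity conditions on cycle lengths; it has opposite signs in the one-cycle and the two-cycle count
  and cancels under the weights 2 and 4. Odd length is what makes these weights uniform:
  \<open>cA\<close> and \<open>cD\<close> of an odd cycle differ, so reversal exchanges two disjoint
  classes and no cycle is counted twice. The recurrences close because removing the least element
  leaves a splitting of a shorter interval, and whether that element creates a drop at a junction
  depends only on which lists are empty. Several of the wanted counts are not determined by their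
  own value one step earlier, so auxiliary counts with conditions on lengths accompany them.\<close>

definition drops :: "nat list \<Rightarrow> nat list \<Rightarrow> bool" where
  "drops a b \<longleftrightarrow> a \<noteq> [] \<and> b \<noteq> [] \<and> hd b < last a"

definition starts_below :: "nat list \<Rightarrow> nat list \<Rightarrow> bool" where
  "starts_below a b \<longleftrightarrow> a \<noteq> [] \<and> b \<noteq> [] \<and> hd a < hd b"

definition splits :: "nat \<Rightarrow> nat \<Rightarrow> (nat list \<times> nat list \<times> nat list) set" where
  "splits m n = {(a, b, c). sorted_wrt (<) a \<and> sorted_wrt (<) b \<and> sorted_wrt (<) c \<and>
     distinct (a @ b @ c) \<and> set (a @ b @ c) = {m..<m + n}}"

lemma splits_0: "splits m 0 = {([], [], [])}"
  by (auto simp: splits_def)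

lemma sorted_wrt_less_head:
  assumes "sorted_wrt (<) (a :: nat list)" "m \<in> set a" "\<forall>x\<in>set a. m \<le> x"
  obtains a' where "a = m # a'"
proof (cases a)
  case (Cons h t)
  with assms have "h = m" by fastforce
  with Cons that show ?thesis by blast
qed (use assms in auto)

lemma splits_gt:
  assumes "(a, b, c) \<in> splits (Suc m) n" "x \<in> set a \<union> set b \<union> set c"
  shows "m < x"
proof -
  have "x \<in> {Suc m..<Suc m + n}" using assms by (simp add: splits_def Un_assoc)
  then show ?thesis by simp
qed

text \<open>The least element can only stand at the head of an increasing list, so it is prepended
  to one of the three. The left end \<open>m\<close> varies because what remains starts at
  \<open>Suc m\<close>.\<close>

lemma splits_Suc:
  "splits m (Suc n) =
     (\<lambda>(a, b, c). (m # a, b, c)) ` splits (Suc m) n \<union>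
     (\<lambda>(a, b, c). (a, m # b, c)) ` splits (Suc m) n \<union>
     (\<lambda>(a, b, c). (a, b, m # c)) ` splits (Suc m) n" (is "?L = ?R")
proof
  have ins: "{m..<m + Suc n} = insert m {Suc m..<Suc m + n}" by auto
  show "?R \<subseteq> ?L"
  proof -
    have "{(m # a, b, c), (a, m # b, c), (a, b, m # c)} \<subseteq> splits m (Suc n)"
      if abc: "(a, b, c) \<in> splits (Suc m) n" for a b c
    proof -
      have "\<forall>x\<in>set a \<union> set b \<union> set c. m < x" using splits_gt[OF abc] by blast
      moreover from this have "m \<notin> set a" "m \<notin> set b" "m \<notin> set c" by auto
      ultimately show ?thesis
        using abc unfolding splits_def ins by simp
    qed
    then show ?thesis by auto
  qed
  show "?L \<subseteq> ?R"
  proof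
    fix t assume "t \<in> ?L"
    then obtain a b c where t: "t = (a, b, c)" and abc: "sorted_wrt (<) a" "sorted_wrt (<) b"
      "sorted_wrt (<) c" "distinct (a @ b @ c)" "set (a @ b @ c) = insert m {Suc m..<Suc m + n}"
      unfolding splits_def ins by auto
    have ge: "\<forall>x\<in>set (a @ b @ c). m \<le> x" using abc(5) by auto
    have del: "B = A" if "insert m B = insert m A" "m \<notin> B" "m \<notin> A" for A B :: "nat set"
      using that by auto
    have mem: "m \<in> set a \<or> m \<in> set b \<or> m \<in> set c" using abc(5) by auto
    then show "t \<in> ?R"
    proof (elim disjE)
      assume "m \<in> set a"
      then obtain a' where a: "a = m # a'" using sorted_wrt_less_head[of a m] abc(1) ge by auto
      have "set (a' @ b @ c) = {Suc m..<Suc m + n}"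
        by (rule del) (use abc a in auto)
      then have "(a', b, c) \<in> splits (Suc m) n" using abc a by (auto simp: splits_def)
      then show ?thesis unfolding t a by force
    next
      assume "m \<in> set b"
      then obtain b' where b: "b = m # b'" using sorted_wrt_less_head[of b m] abc(2) ge by auto
      have "set (a @ b' @ c) = {Suc m..<Suc m + n}"
        by (rule del) (use abc b in auto)
      then have "(a, b', c) \<in> splits (Suc m) n" using abc b by (auto simp: splits_def)
      then show ?thesis unfolding t b by force
    next
      assume "m \<in> set c"
      then obtain c' where c: "c = m # c'" using sorted_wrt_less_head[of c m] abc(3) ge by auto
      have "set (a @ b @ c') = {Suc m..<Suc m + n}"
        by (rule del) (use abc c in auto)
      then have "(a, b, c') \<in> splits (Suc m) n" using abc c by (auto simp: splits_def)
      then show ?thesis unfolding t c by force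
    qed
  qed
qed

lemma finite_splits: "finite (splits m n)"
  by (induction n arbitrary: m) (simp_all add: splits_0 splits_Suc)

text \<open>Counts splittings \<open>(a, b, c)\<close> by the statistics \<open>drops a b\<close>, \<open>drops b c\<close>,
  \<open>starts_below a b\<close>, \<open>length a\<close>, \<open>length b\<close> (called \<open>x\<close>, \<open>y\<close>, \<open>z\<close>, \<open>i\<close>, \<open>j\<close>
  below). The recursion decides which list the
  least element heads: the effect on the five statistics depends on nothing else.\<close>

fun count_splits :: "(bool \<Rightarrow> bool \<Rightarrow> bool \<Rightarrow> nat \<Rightarrow> nat \<Rightarrow> bool) \<Rightarrow> nat \<Rightarrow> int" where
  "count_splits P 0 = of_bool (P False False False 0 0)"
| "count_splits P (Suc n) =
     count_splits (\<lambda>x y z i j. P x y (j \<noteq> 0) (Suc i) j) n +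
     count_splits (\<lambda>x y z i j. P (i \<noteq> 0) y False i (Suc j)) n +
     count_splits (\<lambda>x y z i j. P x (j \<noteq> 0) z i j) n"

definition splits_with where
  "splits_with P m n = {(a, b, c) \<in> splits m n.
     P (drops a b) (drops b c) (starts_below a b) (length a) (length b)}"

lemma splits_with_0:
  "splits_with P m 0 = (if P False False False 0 0 then {([], [], [])} else {})"
  by (auto simp: splits_with_def splits_0 drops_def starts_below_def)

lemma splits_with_Suc:
  "splits_with P m (Suc n) =
     (\<lambda>(a, b, c). (m # a, b, c)) ` splits_with (\<lambda>x y z i j. P x y (j \<noteq> 0) (Suc i) j) (Suc m) n \<union>
     (\<lambda>(a, b, c). (a, m # b, c)) ` splits_with (\<lambda>x y z i j. P (i \<noteq> 0) y False i (Suc j)) (Suc m) n \<union>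
     (\<lambda>(a, b, c). (a, b, m # c)) ` splits_with (\<lambda>x y z i j. P x (j \<noteq> 0) z i j) (Suc m) n"
proof -
  \<comment> \<open>Prepending \<open>m\<close> changes the last entry of a list only if that list
    was empty, and then the last entry is \<open>m\<close>, below everything in the next list: no
    drop arises there. A drop is created by prepending \<open>m\<close> to the list on the right of
    a junction, provided the left one is nonempty.\<close>
  have A: "drops (m # a) b = drops a b" "starts_below (m # a) b = (length b \<noteq> 0)"
    "drops a (m # b) = (length a \<noteq> 0)" "drops (m # b) c = drops b c" "starts_below a (m # b) = False"
    "drops b (m # c) = (length b \<noteq> 0)"
    if "(a, b, c) \<in> splits (Suc m) n" for a b c
    using splits_gt[OF that] unfolding drops_def starts_below_def
    by (auto dest: hd_in_set last_in_set, (meson hd_in_set last_in_set not_less_iff_gr_or_eq)+)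
  have f: "{t \<in> f ` S. Q t} = f ` {t \<in> S. Q (f t)}" for f :: "'x \<Rightarrow> 'y" and S Q by auto
  have "splits_with P m (Suc n) = {t \<in> splits m (Suc n). (\<lambda>(a, b, c).
     P (drops a b) (drops b c) (starts_below a b) (length a) (length b)) t}"
    by (auto simp: splits_with_def)
  also have "\<dots> = (\<lambda>(a, b, c). (m # a, b, c)) ` splits_with (\<lambda>x y z i j. P x y (j \<noteq> 0) (Suc i) j) (Suc m) n \<union>
     (\<lambda>(a, b, c). (a, m # b, c)) ` splits_with (\<lambda>x y z i j. P (i \<noteq> 0) y False i (Suc j)) (Suc m) n \<union>
     (\<lambda>(a, b, c). (a, b, m # c)) ` splits_with (\<lambda>x y z i j. P x (j \<noteq> 0) z i j) (Suc m) n"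
    unfolding splits_Suc Collect_disj_eq Un_iff conj_disj_distribR f
    by (intro arg_cong2[where f = "(\<union>)"] image_cong)
       (auto simp: splits_with_def A simp del: length_0_conv length_greater_0_conv)
  finally show ?thesis .
qed

lemma card_splits_with: "int (card (splits_with P m n)) = count_splits P n"
proof (induction n arbitrary: P m)
  case 0
  then show ?case by (simp add: splits_with_0)
next
  case (Suc n)
  have fin: "finite (splits_with P m n)" for P m n
    unfolding splits_with_def by (rule finite_subset[OF _ finite_splits[of m n]]) auto
  have gt: "m < x" if "(a, b, c) \<in> splits_with Q (Suc m) n" "x \<in> set a \<union> set b \<union> set c" for Q a b c x
    using that splits_gt unfolding splits_with_def by blast
  \<comment> \<open>\<open>m\<close> is absent from every splitting of the remaining interval, so
    its place tells the three images apart.\<close>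
  have m: "(m # a, b, c) \<notin> splits_with Q (Suc m) n" "(a, m # b, c) \<notin> splits_with Q (Suc m) n"
     "(a, b, m # c) \<notin> splits_with Q (Suc m) n" for Q a b c
    using gt[of _ _ _ Q m] by fastforce+
  have "card (f ` splits_with Q (Suc m) n \<union> g ` splits_with R (Suc m) n \<union> h ` splits_with S (Suc m) n) =
      card (splits_with Q (Suc m) n) + card (splits_with R (Suc m) n) + card (splits_with S (Suc m) n)"
    if "f = (\<lambda>(a, b, c). (m # a, b, c))" "g = (\<lambda>(a, b, c). (a, m # b, c))" "h = (\<lambda>(a, b, c). (a, b, m # c))"
    for f g h Q R S
  proof -
    have "inj f" "inj g" "inj h" unfolding that by (auto simp: inj_def)
    then have "card (f ` A) = card A" "card (g ` A) = card A" "card (h ` A) = card A" for A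
      by (auto intro!: card_image intro: inj_on_subset)
    moreover have "f ` splits_with Q (Suc m) n \<inter> g ` splits_with R (Suc m) n = {}"
      "(f ` splits_with Q (Suc m) n \<union> g ` splits_with R (Suc m) n) \<inter> h ` splits_with S (Suc m) n = {}"
      unfolding that using m by auto
    ultimately show ?thesis using fin by (simp add: card_Un_disjoint)
  qed
  from this[OF refl refl refl] show ?case
    unfolding splits_with_Suc by (simp only: of_nat_add Suc.IH count_splits.simps)
qed

text \<open>The recursion never reaches a tuple in which a drop occurs next to an empty list, so the
  predicates have to agree only on tuples compatible with that.\<close>

lemma count_splits_cong:
  assumes "\<And>x y z i j. (x \<Longrightarrow> 0 < i \<and> 0 < j) \<Longrightarrow> (y \<Longrightarrow> 0 < j) \<Longrightarrow> P x y z i j = Q x y z i j"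
  shows "count_splits P n = count_splits Q n"
  using assms
proof (induction n arbitrary: P Q)
  case 0
  then show ?case by simp
next
  case (Suc n)
  show ?case
    unfolding count_splits.simps
    by (intro arg_cong2[where f = "(+)"]; rule Suc.IH; rule Suc.prems; simp)
qed

text \<open>Serves as subtraction: a count with an excluded case is a simpler count minus that
  case.\<close>

lemma count_splits_split:
  "count_splits P n = count_splits (\<lambda>x y z i j. P x y z i j \<and> Q x y z i j) n +
     count_splits (\<lambda>x y z i j. P x y z i j \<and> \<not> Q x y z i j) n"
proof (induction n arbitrary: P Q)
  case (Suc n)
  from Suc.IH[of "\<lambda>x y z i j. P x y (j \<noteq> 0) (Suc i) j" "\<lambda>x y z i j. Q x y (j \<noteq> 0) (Suc i) j"]
    Suc.IH[of "\<lambda>x y z i j. P (i \<noteq> 0) y False i (Suc j)" "\<lambda>x y z i j. Q (i \<noteq> 0) y False i (Suc j)"]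
    Suc.IH[of "\<lambda>x y z i j. P x (j \<noteq> 0) z i j" "\<lambda>x y z i j. Q x (j \<noteq> 0) z i j"]
  show ?case by simp
qed simp

section \<open>Closed forms for counts by drops and list lengths\<close>

lemma count_splits_False [simp]: "count_splits (\<lambda>x y z i j. False) n = 0"
  by (induction n) auto

lemma count_all: "count_splits (\<lambda>x y z i j. True) n = 3 ^ n"
  by (induction n) auto

lemma count_i0: "count_splits (\<lambda>x y z i j. i = 0) n = 2 ^ n"
  by (induction n) auto

lemma count_i_pos: "count_splits (\<lambda>x y z i j. 0 < i) n = 3 ^ n - 2 ^ n"
  by (induction n) (auto simp: count_all)

lemma count_j_pos: "count_splits (\<lambda>x y z i j. 0 < j) n = 3 ^ n - 2 ^ n"
  by (induction n) (auto simp: count_all)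

lemma count_ij_pos: "count_splits (\<lambda>x y z i j. 0 < i \<and> 0 < j) n = 3 ^ n - 2 * 2 ^ n + 1"
  by (induction n) (auto simp: count_i_pos count_j_pos)

text \<open>When the least element joins \<open>b\<close>, a drop is present exactly if
  \<open>a\<close> is nonempty; in the other two places it leaves the drop as it was. Hence X(n+1) =
  2 X(n) + 3^n - 2^n.\<close>

lemma count_x: "2 * count_splits (\<lambda>x y z i j. x) n = 2 * 3 ^ n - (int n + 2) * 2 ^ n"
  by (induction n) (auto simp: count_i_pos algebra_simps)

lemma count_y: "2 * count_splits (\<lambda>x y z i j. y) n = 2 * 3 ^ n - (int n + 2) * 2 ^ n"
  by (induction n) (auto simp: count_j_pos algebra_simps)

lemma count_i_pos_y: "2 * count_splits (\<lambda>x y z i j. 0 < i \<and> y) n = 2 * 3 ^ n - (int n + 4) * 2 ^ n + 2 * int n + 2"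
proof (induction n)
  case (Suc n)
  then show ?case using count_y[of n] by (simp add: count_ij_pos algebra_simps)
qed simp

text \<open>Half of the right-hand side is the classical 3^n - (n+1) 2^n + (n+1 choose 2) for
  E(n,2). The recurrence adds \<open>count_i_pos_y\<close> when the least element joins
  \<open>b\<close> and \<open>count_x\<close> when it joins \<open>c\<close>.\<close>

lemma count_xy: "2 * count_splits (\<lambda>x y z i j. x \<and> y) n = 2 * 3 ^ n - 2 * (int n + 1) * 2 ^ n + int n * (int n + 1)"
proof (induction n)
  case (Suc n)
  have "count_splits (\<lambda>x y z i j. x \<and> 0 < j) n = count_splits (\<lambda>x y z i j. x) n"
    by (rule count_splits_cong) auto
  with Suc show ?case using count_x[of n] count_i_pos_y[of n] by (simp add: algebra_simps)
qed simp

lemma count_i0_j_pos: "count_splits (\<lambda>x y z i j. i = 0 \<and> 0 < j) n = 2 ^ n - 1"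
  by (induction n) (auto simp: count_i0)

lemma count_i0_y: "count_splits (\<lambda>x y z i j. i = 0 \<and> y) n = 2 ^ n - 1 - int n"
  by (induction n) (auto simp: count_i0_j_pos)

lemma count_i1: "2 * count_splits (\<lambda>x y z i j. i = 1) n = int n * 2 ^ n"
  by (induction n) (auto simp: count_i0 algebra_simps)

lemma count_i1_j_pos: "2 * count_splits (\<lambda>x y z i j. i = 1 \<and> 0 < j) n = int n * 2 ^ n - 2 * int n"
proof (induction n)
  case (Suc n)
  then show ?case using count_i1[of n] by (simp add: count_i0_j_pos algebra_simps)
qed simp

lemma count_i1_y: "2 * count_splits (\<lambda>x y z i j. i = 1 \<and> y) n = int n * 2 ^ n - 2 * (int n)\<^sup>2"
proof (induction n)
  case (Suc n)
  then show ?case using count_i1_j_pos[of n] by (simp add: count_i0_y algebra_simps power2_eq_square)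
qed simp

lemma count_i1_x: "2 * count_splits (\<lambda>x y z i j. i = 1 \<and> x) n = (int n - 2) * 2 ^ n + 2"
proof (induction n)
  case (Suc n)
  have "count_splits (\<lambda>x y z i j. i = 0 \<and> x) n = count_splits (\<lambda>x y z i j. False) n"
    by (rule count_splits_cong) auto
  moreover have "count_splits (\<lambda>x y z i j. i = 1 \<and> 0 < i) n = count_splits (\<lambda>x y z i j. i = 1) n"
    by (rule count_splits_cong) auto
  ultimately show ?case using Suc count_i1[of n] by (simp add: algebra_simps)
qed simp

text \<open>One step of the recursion settles it: joining \<open>a\<close> would need a drop after
  an empty list, and joining \<open>b\<close> or \<open>c\<close> makes one of the two drops
  automatic.\<close>

lemma count_i1_xy: "count_splits (\<lambda>x y z i j. i = 1 \<and> x \<and> y) (Suc n) = (int n - 1) * 2 ^ n - (int n)\<^sup>2 + 1"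
proof -
  have "count_splits (\<lambda>x y z i j. i = 0 \<and> x \<and> y) n = count_splits (\<lambda>x y z i j. False) n"
    by (rule count_splits_cong) auto
  moreover have "count_splits (\<lambda>x y z i j. i = 1 \<and> 0 < i \<and> y) n = count_splits (\<lambda>x y z i j. i = 1 \<and> y) n"
    by (rule count_splits_cong) auto
  moreover have "count_splits (\<lambda>x y z i j. i = 1 \<and> x \<and> 0 < j) n = count_splits (\<lambda>x y z i j. i = 1 \<and> x) n"
    by (rule count_splits_cong) auto
  ultimately show ?thesis using count_i1_x[of n] count_i1_y[of n] by (simp add: algebra_simps)
qed

lemma count_i1_j0: "count_splits (\<lambda>x y z i j. i = 1 \<and> j = 0) n = int n"
proof (induction n)
  case (Suc n)
  have "count_splits (\<lambda>x y z i j. i = 0 \<and> j = 0) n = 1" by (induction n) auto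
  with Suc show ?case by simp
qed simp

lemma count_i0_j1: "count_splits (\<lambda>x y z i j. i = 0 \<and> j = 1) n = int n"
proof (induction n)
  case (Suc n)
  have "count_splits (\<lambda>x y z i j. i = 0 \<and> j = 0) n = 1" by (induction n) auto
  with Suc show ?case by simp
qed simp

lemma count_i2_j0: "2 * count_splits (\<lambda>x y z i j. i = 2 \<and> j = 0) n = int n * (int n - 1)"
proof (induction n)
  case (Suc n)
  then show ?case using count_i1_j0[of n] by (simp add: numeral_2_eq_2 algebra_simps)
qed simp

lemma count_i1_j1_x: "2 * count_splits (\<lambda>x y z i j. i = 1 \<and> j = 1 \<and> x) n = int n * (int n - 1)"
proof (induction n)
  case (Suc n)
  have "count_splits (\<lambda>x y z i j. i = 0 \<and> j = 1 \<and> x) n = count_splits (\<lambda>x y z i j. False) n"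
    by (rule count_splits_cong) auto
  moreover have "count_splits (\<lambda>x y z i j. i = 1 \<and> j = 0 \<and> 0 < i) n = count_splits (\<lambda>x y z i j. i = 1 \<and> j = 0) n"
    by (rule count_splits_cong) auto
  ultimately show ?case using Suc count_i1_j0[of n] by (simp add: algebra_simps)
qed simp

lemma count_i2_j1_x:
  "3 * count_splits (\<lambda>x y z i j. i = 2 \<and> j = 1 \<and> x) n = int n * (int n - 1) * (int n - 2)"
proof (induction n)
  case (Suc n)
  have "count_splits (\<lambda>x y z i j. i = 2 \<and> j = 0 \<and> 0 < i) n = count_splits (\<lambda>x y z i j. i = 2 \<and> j = 0) n"
    by (rule count_splits_cong) auto
  then show ?case using Suc count_i2_j0[of n] count_i1_j1_x[of n] by (simp add: numeral_2_eq_2 algebra_simps)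
qed simp

text \<open>Joining \<open>b\<close>, the least element would have to leave \<open>b\<close> empty
  before a drop to \<open>c\<close>, so only \<open>a\<close> and \<open>c\<close> can receive it;
  after one step through \<open>a\<close>, only \<open>c\<close> can. Two unfoldings therefore
  suffice.\<close>

lemma count_i2_j1_xy:
  "6 * count_splits (\<lambda>x y z i j. i = 2 \<and> j = 1 \<and> x \<and> y) (Suc (Suc n)) =
     2 * (int n + 1) * int n * (int n - 1) + 3 * int n * (int n - 1)"
proof -
  have 1: "count_splits (\<lambda>x y z i j. i = 2 \<and> j = 1 \<and> x \<and> y) (Suc k) =
    count_splits (\<lambda>x y z i j. i = 1 \<and> j = 1 \<and> x \<and> y) k + count_splits (\<lambda>x y z i j. i = 2 \<and> j = 1 \<and> x) k" for k
  proof -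
    have "count_splits (\<lambda>x y z i j. i = 2 \<and> j = 0 \<and> 0 < i \<and> y) k = count_splits (\<lambda>x y z i j. False) k"
      by (rule count_splits_cong) auto
    moreover have "count_splits (\<lambda>x y z i j. i = 2 \<and> j = 1 \<and> x \<and> 0 < j) k = count_splits (\<lambda>x y z i j. i = 2 \<and> j = 1 \<and> x) k"
      by (rule count_splits_cong) auto
    ultimately show ?thesis by (simp add: numeral_2_eq_2)
  qed
  have 2: "count_splits (\<lambda>x y z i j. i = 1 \<and> j = 1 \<and> x \<and> y) (Suc k) = count_splits (\<lambda>x y z i j. i = 1 \<and> j = 1 \<and> x) k" for k
  proof -
    have "count_splits (\<lambda>x y z i j. i = 0 \<and> j = 1 \<and> x \<and> y) k = count_splits (\<lambda>x y z i j. False) k"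
      by (rule count_splits_cong) auto
    moreover have "count_splits (\<lambda>x y z i j. i = 1 \<and> j = 0 \<and> 0 < i \<and> y) k = count_splits (\<lambda>x y z i j. False) k"
      by (rule count_splits_cong) auto
    moreover have "count_splits (\<lambda>x y z i j. i = 1 \<and> j = 1 \<and> x \<and> 0 < j) k = count_splits (\<lambda>x y z i j. i = 1 \<and> j = 1 \<and> x) k"
      by (rule count_splits_cong) auto
    ultimately show ?thesis by simp
  qed
  show ?thesis
    unfolding 1 2 using count_i1_j1_x[of n] count_i2_j1_x[of "Suc n"] by (simp add: algebra_simps)
qed

section \<open>Split conditions for the two sides of the identity\<close>

definition ballot_split :: "bool \<Rightarrow> bool \<Rightarrow> bool \<Rightarrow> nat \<Rightarrow> nat \<Rightarrow> bool" where
  "ballot_split x y z i j \<longleftrightarrow> x \<and> y \<and> i \<noteq> 1 \<and> \<not> (i = 2 \<and> j = 1)"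

text \<open>\<open>z\<close> makes \<open>hd a\<close> the least entry of \<open>a @ b\<close>, as
  the canonical rotation demands. A cycle of length 3 with two cyclic descents has one cyclic
  ascent, hence \<open>cycle_M\<close> 1, so the odd lengths start at 5.\<close>

definition one_cycle_split :: "bool \<Rightarrow> bool \<Rightarrow> bool \<Rightarrow> nat \<Rightarrow> nat \<Rightarrow> bool" where
  "one_cycle_split x y z i j \<longleftrightarrow> x \<and> z \<and> odd (i + j) \<and> 5 \<le> i + j"

text \<open>\<open>z\<close> orders the two cycles by their least entries, so an unordered pair is
  counted once. Length 1 is left to the fixed points.\<close>

definition two_cycle_split :: "bool \<Rightarrow> bool \<Rightarrow> bool \<Rightarrow> nat \<Rightarrow> nat \<Rightarrow> bool" where
  "two_cycle_split x y z i j \<longleftrightarrow> z \<and> odd i \<and> odd j \<and> 3 \<le> i \<and> 3 \<le> j"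

text \<open>The two ways of violating the ballot condition exclude each other, so both counts are
  subtracted from \<open>count_xy\<close>.\<close>

lemma count_ballot_split:
  "3 * count_splits ballot_split (Suc (Suc n)) = 27 * 3 ^ n - 18 * (int n + 2) * 2 ^ n
     - int n ^ 3 + 3 * (int n)\<^sup>2 + 16 * int n + 9"
proof -
  let ?N = "Suc (Suc n)"
  have "count_splits (\<lambda>x y z i j. x \<and> y) ?N = count_splits (\<lambda>x y z i j. i = 1 \<and> x \<and> y) ?N
     + count_splits (\<lambda>x y z i j. i = 2 \<and> j = 1 \<and> x \<and> y) ?N + count_splits ballot_split ?N"
  proof -
    have "count_splits (\<lambda>x y z i j. (x \<and> y) \<and> i = 1) ?N = count_splits (\<lambda>x y z i j. i = 1 \<and> x \<and> y) ?N"
      by (rule count_splits_cong) auto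
    moreover have "count_splits (\<lambda>x y z i j. ((x \<and> y) \<and> i \<noteq> 1) \<and> (i = 2 \<and> j = 1)) ?N =
       count_splits (\<lambda>x y z i j. i = 2 \<and> j = 1 \<and> x \<and> y) ?N"
      by (rule count_splits_cong) auto
    moreover have "count_splits (\<lambda>x y z i j. ((x \<and> y) \<and> i \<noteq> 1) \<and> \<not> (i = 2 \<and> j = 1)) ?N =
       count_splits ballot_split ?N"
      by (rule count_splits_cong) (auto simp: ballot_split_def)
    ultimately show ?thesis
      using count_splits_split[of "\<lambda>x y z i j. x \<and> y" ?N "\<lambda>x y z i j. i = 1"]
        count_splits_split[of "\<lambda>x y z i j. (x \<and> y) \<and> i \<noteq> 1" ?N "\<lambda>x y z i j. i = 2 \<and> j = 1"]
      by linarith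
  qed
  then show ?thesis
    using count_xy[of ?N] count_i1_xy[of "Suc n"] count_i2_j1_xy[of n]
    by (simp del: count_splits.simps add: algebra_simps power2_eq_square power3_eq_cube)
qed

section \<open>Parity-restricted counts for odd cycles\<close>

text \<open>Joining \<open>a\<close> or \<open>b\<close> flips the parity and joining
  \<open>c\<close> keeps it, so each step multiplies the sum of the two counts by 3 and their
  difference by -1. Each count feeds the other, hence the simultaneous induction.\<close>

lemma count_parity_sum:
  "2 * count_splits (\<lambda>x y z i j. even (i + j)) n = 3 ^ n + (-1) ^ n \<and>
   2 * count_splits (\<lambda>x y z i j. odd (i + j)) n = 3 ^ n - (-1) ^ n"
  by (induction n) (auto simp del: even_add odd_add)

lemma count_parities:
  "4 * count_splits (\<lambda>x y z i j. even i \<and> even j) n = 3 ^ n + 2 + (-1) ^ n \<and>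
   4 * count_splits (\<lambda>x y z i j. even i \<and> odd j) n = 3 ^ n - (-1) ^ n \<and>
   4 * count_splits (\<lambda>x y z i j. odd i \<and> even j) n = 3 ^ n - (-1) ^ n \<and>
   4 * count_splits (\<lambda>x y z i j. odd i \<and> odd j) n = 3 ^ n - 2 + (-1) ^ n"
  by (induction n) auto

lemma count_i0_parity:
  "count_splits (\<lambda>x y z i j. i = 0 \<and> odd j) (Suc n) = 2 ^ n \<and>
   count_splits (\<lambda>x y z i j. i = 0 \<and> even j) (Suc n) = 2 ^ n"
  by (induction n) auto

lemma count_j0_parity:
  "count_splits (\<lambda>x y z i j. odd i \<and> j = 0) (Suc n) = 2 ^ n \<and>
   count_splits (\<lambda>x y z i j. even i \<and> j = 0) (Suc n) = 2 ^ n"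
  by (induction n) auto

text \<open>The two counts agree only from index 2 on; at index 1 they are 1 and 0.\<close>

lemma count_j1_parity:
  "count_splits (\<lambda>x y z i j. even i \<and> j = 1) (Suc (Suc n)) = (int n + 2) * 2 ^ n \<and>
   count_splits (\<lambda>x y z i j. odd i \<and> j = 1) (Suc (Suc n)) = (int n + 2) * 2 ^ n"
proof (induction n)
  case 0
  show ?case by simp
next
  case (Suc n)
  let ?m = "Suc (Suc n)"
  have "count_splits (\<lambda>x y z i j. even i \<and> j = 1) (Suc ?m) = count_splits (\<lambda>x y z i j. odd i \<and> j = 1) ?m
     + count_splits (\<lambda>x y z i j. even i \<and> j = 0) ?m + count_splits (\<lambda>x y z i j. even i \<and> j = 1) ?m"
    by (subst count_splits.simps) (simp del: count_splits.simps)
  moreover have "count_splits (\<lambda>x y z i j. odd i \<and> j = 1) (Suc ?m) = count_splits (\<lambda>x y z i j. even i \<and> j = 1) ?m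
     + count_splits (\<lambda>x y z i j. odd i \<and> j = 0) ?m + count_splits (\<lambda>x y z i j. odd i \<and> j = 1) ?m"
    by (subst count_splits.simps) (simp del: count_splits.simps)
  ultimately show ?case
    using Suc count_j0_parity[of "Suc n"] by (simp del: count_splits.simps add: algebra_simps)
qed

text \<open>Joining \<open>a\<close> requires a drop and an odd total, joining \<open>c\<close> a
  drop and an even total; together these make up all of \<open>count_x\<close>. Only the
  contribution of joining \<open>b\<close> still depends on parity.\<close>

lemma count_x_even:
  "2 * count_splits (\<lambda>x y z i j. x \<and> even (i + j)) (Suc (Suc n)) = 9 * 3 ^ n - (2 * int n + 8) * 2 ^ n + (-1) ^ n"
proof -
  let ?m = "Suc n"
  have "count_splits (\<lambda>x y z i j. x \<and> even (i + j)) (Suc ?m) = count_splits (\<lambda>x y z i j. x \<and> odd (i + j)) ?m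
     + count_splits (\<lambda>x y z i j. 0 < i \<and> odd (i + j)) ?m + count_splits (\<lambda>x y z i j. x \<and> even (i + j)) ?m"
    by (subst count_splits.simps) (simp del: count_splits.simps)
  moreover have "count_splits (\<lambda>x y z i j. odd (i + j) \<and> i = 0) ?m = count_splits (\<lambda>x y z i j. i = 0 \<and> odd j) ?m"
    by (rule count_splits_cong) auto
  moreover have "count_splits (\<lambda>x y z i j. odd (i + j) \<and> i \<noteq> 0) ?m = count_splits (\<lambda>x y z i j. 0 < i \<and> odd (i + j)) ?m"
    by (rule count_splits_cong) auto
  ultimately show ?thesis
    using count_splits_split[of "\<lambda>x y z i j. x" ?m "\<lambda>x y z i j. even (i + j)"]
      count_splits_split[of "\<lambda>x y z i j. odd (i + j)" ?m "\<lambda>x y z i j. i = 0"]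
      count_x[of ?m] count_i0_parity[of n] count_parity_sum[of ?m]
    by (simp del: count_splits.simps add: algebra_simps)
qed

text \<open>Joining \<open>b\<close> destroys \<open>z\<close> and joining \<open>c\<close> changes
  nothing. Joining \<open>a\<close> leaves the condition of an even total of at least 4; as a drop
  already forces a total of at least 2, this excludes only i = j = 1.\<close>

lemma count_one_cycle_split:
  "12 * count_splits one_cycle_split (Suc (Suc n)) =
     27 * 3 ^ n - 12 * (int n + 2) * 2 ^ n - 3 * (-1) ^ n - 2 * int n * (int n + 1) * (int n + 2)"
proof (induction n)
  case 0
  show ?case by (simp add: one_cycle_split_def)
next
  case (Suc n)
  let ?m = "Suc (Suc n)"
  have "count_splits one_cycle_split (Suc ?m) =
     count_splits (\<lambda>x y z i j. (x \<and> even (i + j)) \<and> \<not> (i = 1 \<and> j = 1)) ?m + count_splits one_cycle_split ?m"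
  proof -
    have "count_splits (\<lambda>x y z i j. one_cycle_split x y (j \<noteq> 0) (Suc i) j) ?m =
       count_splits (\<lambda>x y z i j. (x \<and> even (i + j)) \<and> \<not> (i = 1 \<and> j = 1)) ?m"
      by (rule count_splits_cong) (auto simp: one_cycle_split_def, presburger+)
    moreover have "count_splits (\<lambda>x y z i j. one_cycle_split (i \<noteq> 0) y False i (Suc j)) ?m =
       count_splits (\<lambda>x y z i j. False) ?m"
      by (rule count_splits_cong) (auto simp: one_cycle_split_def)
    moreover have "count_splits (\<lambda>x y z i j. one_cycle_split x (j \<noteq> 0) z i j) ?m = count_splits one_cycle_split ?m"
      by (rule count_splits_cong) (auto simp: one_cycle_split_def)
    ultimately show ?thesis
      by (subst count_splits.simps) (simp del: count_splits.simps)
  qed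
  moreover have "count_splits (\<lambda>x y z i j. (x \<and> even (i + j)) \<and> i = 1 \<and> j = 1) ?m =
      count_splits (\<lambda>x y z i j. i = 1 \<and> j = 1 \<and> x) ?m"
    by (rule count_splits_cong) auto
  ultimately show ?case
    using Suc count_i1_j1_x[of ?m] count_x_even[of n]
      count_splits_split[of "\<lambda>x y z i j. x \<and> even (i + j)" ?m "\<lambda>x y z i j. i = 1 \<and> j = 1"]
    by (simp del: count_splits.simps add: algebra_simps)
qed

text \<open>Only joining \<open>a\<close> creates new cases: i even and nonzero, j odd and different
  from 1. The exclusions are removed one after the other, the case j = 1 only for nonzero i, so that
  i = 0, j = 1 is not subtracted twice.\<close>

lemma count_two_cycle_split:
  "8 * count_splits two_cycle_split (Suc (Suc n)) =
     9 * 3 ^ n + (-1) ^ n - 8 * (int n + 2) * 2 ^ n + 4 * (int n)\<^sup>2 + 12 * int n + 6"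
proof (induction n)
  case 0
  show ?case by (simp add: two_cycle_split_def)
next
  case (Suc n)
  let ?m = "Suc (Suc n)"
  have "count_splits two_cycle_split (Suc ?m) =
     count_splits (\<lambda>x y z i j. ((even i \<and> odd j) \<and> i \<noteq> 0) \<and> j \<noteq> 1) ?m + count_splits two_cycle_split ?m"
  proof -
    have "count_splits (\<lambda>x y z i j. two_cycle_split x y (j \<noteq> 0) (Suc i) j) ?m =
       count_splits (\<lambda>x y z i j. ((even i \<and> odd j) \<and> i \<noteq> 0) \<and> j \<noteq> 1) ?m"
      by (rule count_splits_cong) (auto simp: two_cycle_split_def, presburger+)
    moreover have "count_splits (\<lambda>x y z i j. two_cycle_split (i \<noteq> 0) y False i (Suc j)) ?m =
       count_splits (\<lambda>x y z i j. False) ?m"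
      by (rule count_splits_cong) (auto simp: two_cycle_split_def)
    moreover have "count_splits (\<lambda>x y z i j. two_cycle_split x (j \<noteq> 0) z i j) ?m = count_splits two_cycle_split ?m"
      by (rule count_splits_cong) (auto simp: two_cycle_split_def)
    ultimately show ?thesis
      by (subst count_splits.simps) (simp del: count_splits.simps)
  qed
  moreover have "count_splits (\<lambda>x y z i j. (even i \<and> odd j) \<and> i = 0) ?m = count_splits (\<lambda>x y z i j. i = 0 \<and> odd j) ?m"
    by (rule count_splits_cong) auto
  moreover have "count_splits (\<lambda>x y z i j. ((even i \<and> odd j) \<and> i \<noteq> 0) \<and> j = 1) ?m =
     count_splits (\<lambda>x y z i j. (even i \<and> j = 1) \<and> i \<noteq> 0) ?m"
    by (rule count_splits_cong) auto
  moreover have "count_splits (\<lambda>x y z i j. (even i \<and> j = 1) \<and> i = 0) ?m = count_splits (\<lambda>x y z i j. i = 0 \<and> j = 1) ?m"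
    by (rule count_splits_cong) auto
  ultimately show ?case
    using Suc count_parities[of ?m] count_i0_parity[of "Suc n"] count_j1_parity[of n] count_i0_j1[of ?m]
      count_splits_split[of "\<lambda>x y z i j. even i \<and> odd j" ?m "\<lambda>x y z i j. i = 0"]
      count_splits_split[of "\<lambda>x y z i j. (even i \<and> odd j) \<and> i \<noteq> 0" ?m "\<lambda>x y z i j. j = 1"]
      count_splits_split[of "\<lambda>x y z i j. even i \<and> j = 1" ?m "\<lambda>x y z i j. i = 0"]
    by (simp del: count_splits.simps add: algebra_simps power2_eq_square)
qed

section \<open>Permutations with two descents\<close>

text \<open>Recording the 0-based index of the lower entry gives the usual 1-based descent position,
  and cutting there leaves a prefix of exactly that length.\<close>

definition list_descents :: "nat list \<Rightarrow> nat set" where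
  "list_descents xs = {i. 0 < i \<and> i < length xs \<and> xs ! i < xs ! (i - 1)}"

lemma finite_list_descents [simp]: "finite (list_descents xs)"
  by (rule finite_subset[of _ "{..<length xs}"]) (auto simp: list_descents_def)

lemma list_descents_append:
  "list_descents (a @ b) = list_descents a \<union> (if drops a b then {length a} else {}) \<union>
     (+) (length a) ` list_descents b" (is "_ = ?R")
proof (rule set_eqI)
  fix i
  consider "i < length a" | "i = length a" | k where "i = length a + k" "0 < k"
    by (metis less_imp_add_positive linorder_neqE_nat)
  then show "i \<in> list_descents (a @ b) \<longleftrightarrow> i \<in> ?R"
  proof cases
    case 1
    then show ?thesis by (auto simp: list_descents_def nth_append)
  next
    case 2
    then show ?thesis
      by (auto simp: list_descents_def nth_append drops_def hd_conv_nth last_conv_nth)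
  next
    case 3
    then show ?thesis by (auto simp: list_descents_def nth_append image_iff)
  qed
qed

lemma list_descents_empty_iff:
  assumes "distinct xs"
  shows "list_descents xs = {} \<longleftrightarrow> sorted_wrt (<) xs"
proof -
  have "sorted_wrt (<) xs \<longleftrightarrow> (\<forall>i. Suc i < length xs \<longrightarrow> xs ! i < xs ! Suc i)"
    by (rule sorted_wrt_iff_nth_Suc_transp) (auto simp: transp_def)
  also have "\<dots> \<longleftrightarrow> (\<forall>i. Suc i < length xs \<longrightarrow> \<not> xs ! Suc i < xs ! i)"
    using nth_eq_iff_index_eq[OF assms, of i "Suc i" for i] by (auto simp: nat_neq_iff)
  also have "\<dots> \<longleftrightarrow> list_descents xs = {}"
    unfolding list_descents_def by (auto, metis Suc_pred)
  finally show ?thesis by simp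
qed

lemma list_descents_split:
  assumes "i \<in> list_descents xs"
  obtains a b where "xs = a @ b" "length a = i" "drops a b"
proof
  show "xs = take i xs @ drop i xs" by simp
  show "length (take i xs) = i" using assms by (auto simp: list_descents_def)
  have "take i xs \<noteq> []" using assms by (auto simp: list_descents_def)
  from last_conv_nth[OF this] show "drops (take i xs) (drop i xs)"
    using assms by (auto simp: list_descents_def drops_def hd_drop_conv_nth min_def)
qed

lemma list_descents_singleton_iff:
  assumes "distinct xs"
  shows "list_descents xs = {i} \<longleftrightarrow> (\<exists>a b. xs = a @ b \<and> length a = i \<and> drops a b \<and>
           sorted_wrt (<) a \<and> sorted_wrt (<) b)"
proof
  assume L: "list_descents xs = {i}"
  then obtain a b where ab: "xs = a @ b" "length a = i" "drops a b"
    by (metis insertI1 list_descents_split)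
  have "list_descents a \<union> (+) i ` list_descents b \<subseteq> {i}"
    using L ab by (auto simp: list_descents_append)
  moreover have "i \<notin> list_descents a" "i \<notin> (+) i ` list_descents b"
    using ab by (auto simp: list_descents_def)
  ultimately have "list_descents a = {}" "list_descents b = {}" by auto
  then show "\<exists>a b. xs = a @ b \<and> length a = i \<and> drops a b \<and> sorted_wrt (<) a \<and> sorted_wrt (<) b"
    using ab assms by (auto simp: list_descents_empty_iff)
next
  assume "\<exists>a b. xs = a @ b \<and> length a = i \<and> drops a b \<and> sorted_wrt (<) a \<and> sorted_wrt (<) b"
  then obtain a b where "xs = a @ b" "length a = i" "drops a b" "sorted_wrt (<) a" "sorted_wrt (<) b"
    by blast
  then show "list_descents xs = {i}"
    using assms list_descents_empty_iff[of a] list_descents_empty_iff[of b]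
    by (simp add: list_descents_append)
qed

text \<open>Cutting at the first descent leaves a list with a single descent. Writing the set as {i,
  i + k} makes i and k the lengths of the first two increasing blocks.\<close>

lemma list_descents_pair_iff:
  assumes "distinct xs" "0 < k"
  shows "list_descents xs = {i, i + k} \<longleftrightarrow> (\<exists>a b c. xs = a @ b @ c \<and> length a = i \<and> length b = k \<and>
           drops a b \<and> drops b c \<and> sorted_wrt (<) a \<and> sorted_wrt (<) b \<and> sorted_wrt (<) c)"
proof
  assume L: "list_descents xs = {i, i + k}"
  then obtain a b where ab: "xs = a @ b" "length a = i" "drops a b"
    by (metis insertI1 list_descents_split)
  have "list_descents a \<subseteq> {i, i + k}"
    using L ab by (auto simp: list_descents_append)
  then have a: "list_descents a = {}"
    using ab by (auto simp: list_descents_def)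
  have "list_descents b = {k}"
  proof -
    have "{i} \<union> (+) i ` list_descents b = {i, i + k}"
      using L ab a by (simp add: list_descents_append)
    moreover have "i \<notin> (+) i ` list_descents b" by (auto simp: list_descents_def)
    ultimately have "(+) i ` list_descents b = {i, i + k} - {i}" by (metis Diff_insert_absorb insert_is_Un)
    then have "(+) i ` list_descents b = (+) i ` {k}" using assms(2) by auto
    then show ?thesis by (subst (asm) inj_image_eq_iff) (auto simp: inj_def)
  qed
  then obtain b' c where "b = b' @ c" "length b' = k" "drops b' c" "sorted_wrt (<) b'" "sorted_wrt (<) c"
    using list_descents_singleton_iff[of b k] ab assms by auto
  moreover from this have "drops a b'" using ab by (auto simp: drops_def)
  ultimately show "\<exists>a b c. xs = a @ b @ c \<and> length a = i \<and> length b = k \<and>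
           drops a b \<and> drops b c \<and> sorted_wrt (<) a \<and> sorted_wrt (<) b \<and> sorted_wrt (<) c"
    using ab assms a list_descents_empty_iff[of a] by auto
next
  assume "\<exists>a b c. xs = a @ b @ c \<and> length a = i \<and> length b = k \<and>
           drops a b \<and> drops b c \<and> sorted_wrt (<) a \<and> sorted_wrt (<) b \<and> sorted_wrt (<) c"
  then obtain a b c where abc: "xs = a @ b @ c" "length a = i" "length b = k" "drops a b" "drops b c"
      "sorted_wrt (<) a" "sorted_wrt (<) b" "sorted_wrt (<) c"
    by blast
  then have "list_descents (b @ c) = {k}"
    using list_descents_singleton_iff[of "b @ c" k] assms by auto
  moreover have "drops a (b @ c)" using abc by (auto simp: drops_def)
  ultimately show "list_descents xs = {i, i + k}"
    using abc assms list_descents_empty_iff[of a] by (auto simp: list_descents_append[of a "b @ c"])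
qed

lemma descents_eq_list_descents: "descents n \<pi> = list_descents (map \<pi> [1..<Suc n])"
  by (auto simp: descents_def list_descents_def simp del: upt_Suc)

lemma bij_betw_permutes_lists:
  "bij_betw (\<lambda>\<pi>. map \<pi> [1..<Suc n]) {\<pi>. \<pi> permutes {1..n}} (permutations_of_set {1..n})"
proof -
  let ?f = "\<lambda>\<pi>. map \<pi> [1..<Suc n]"
  have inj: "inj_on ?f {\<pi>. \<pi> permutes {1..n}}"
  proof (rule inj_onI, rule ext)
    fix \<pi> \<sigma> x assume "\<pi> \<in> {\<pi>. \<pi> permutes {1..n}}" "\<sigma> \<in> {\<pi>. \<pi> permutes {1..n}}" "?f \<pi> = ?f \<sigma>"
    then show "\<pi> x = \<sigma> x"
      by (cases "x \<in> {1..n}") (auto simp: permutes_not_in simp del: upt_Suc)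
  qed
  have "set (?f \<pi>) = {1..n} \<and> distinct (?f \<pi>)" if "\<pi> permutes {1..n}" for \<pi>
  proof -
    have "set [1..<Suc n] = {1..n}" by auto
    then show ?thesis
      using permutes_image[OF that] permutes_inj_on[OF that] by (simp add: distinct_map del: upt_Suc set_upt)
  qed
  then have "?f ` {\<pi>. \<pi> permutes {1..n}} \<subseteq> permutations_of_set {1..n}"
    by (auto intro!: permutations_of_setI simp del: upt_Suc)
  \<comment> \<open>Surjectivity by counting: both sets have n! elements.\<close>
  moreover have "card (?f ` {\<pi>. \<pi> permutes {1..n}}) = card (permutations_of_set {1..n})"
    unfolding card_image[OF inj] by (simp add: card_permutations[OF refl])
  ultimately have "?f ` {\<pi>. \<pi> permutes {1..n}} = permutations_of_set {1..n}"
    by (intro card_subset_eq) auto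
  with inj show ?thesis by (simp add: bij_betw_def)
qed

text \<open>\<open>Q\<close> constrains the descent positions through the block lengths, so one
  bijection serves both the Eulerian number and the ballot number.\<close>

lemma card_two_descents:
  "card {\<pi>. \<pi> permutes {1..n} \<and> (\<exists>i k. 0 < k \<and> descents n \<pi> = {i, i + k} \<and> Q i k)} =
   card (splits_with (\<lambda>x y z i j. x \<and> y \<and> Q i j) 1 n)"
proof -
  let ?L = "{xs \<in> permutations_of_set {1..n}. \<exists>i k. 0 < k \<and> list_descents xs = {i, i + k} \<and> Q i k}"
  let ?S = "splits_with (\<lambda>x y z i j. x \<and> y \<and> Q i j) 1 n"
  have 1: "bij_betw (\<lambda>\<pi>. map \<pi> [1..<Suc n])
      {\<pi> \<in> {\<pi>. \<pi> permutes {1..n}}. \<exists>i k. 0 < k \<and> descents n \<pi> = {i, i + k} \<and> Q i k} ?L"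
    by (rule bij_betw_Collect[OF bij_betw_permutes_lists])
       (simp only: descents_eq_list_descents)
  have 2: "bij_betw (\<lambda>(a, b, c). a @ b @ c) ?S ?L"
  proof (rule bij_betw_imageI)
    have S: "list_descents (a @ b @ c) = {length a, length a + length b} \<and> 0 < length b \<and>
        a @ b @ c \<in> permutations_of_set {1..n} \<and> Q (length a) (length b)"
      if "(a, b, c) \<in> ?S" for a b c
    proof -
      have *: "drops a b" "drops b c" "distinct (a @ b @ c)" "set (a @ b @ c) = {1..<1 + n}"
        "sorted_wrt (<) a" "sorted_wrt (<) b" "sorted_wrt (<) c" "Q (length a) (length b)"
        using that unfolding splits_with_def splits_def by auto
      moreover have "0 < length b" using * by (auto simp: drops_def)
      moreover have "a @ b @ c \<in> permutations_of_set {1..n}"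
        by (rule permutations_of_setI) (use * in auto)
      ultimately show ?thesis
        using list_descents_pair_iff[of "a @ b @ c" "length b" "length a"] by blast
    qed
    show "inj_on (\<lambda>(a, b, c). a @ b @ c) ?S"
    proof (rule inj_onI)
      fix t t' assume tt': "t \<in> ?S" "t' \<in> ?S" "(\<lambda>(a, b, c). a @ b @ c) t = (\<lambda>(a, b, c). a @ b @ c) t'"
      obtain a b c a' b' c' where t: "t = (a, b, c)" "t' = (a', b', c')" by (metis surj_pair)
      have eq: "a @ b @ c = a' @ b' @ c'" using tt' t by simp
      note S[OF tt'(1)[unfolded t]] S[OF tt'(2)[unfolded t]]
      then have "{length a, length a + length b} = {length a', length a' + length b'}"
        "0 < length b" "0 < length b'" using eq by auto
      \<comment> \<open>Since \<open>b\<close> and \<open>b'\<close> are nonempty, each doubleton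
        lists its smaller element first, so the equality holds componentwise.\<close>
      then have "length a = length a' \<and> length b = length b'" by (auto simp: doubleton_eq_iff)
      with eq t show "t = t'" by auto
    qed
    show "(\<lambda>(a, b, c). a @ b @ c) ` ?S = ?L"
    proof
      show "(\<lambda>(a, b, c). a @ b @ c) ` ?S \<subseteq> ?L"
      proof (rule image_subsetI)
        fix t assume "t \<in> ?S"
        moreover obtain a b c where "t = (a, b, c)" by (metis surj_pair)
        ultimately show "(case t of (a, b, c) \<Rightarrow> a @ b @ c) \<in> ?L" using S[of a b c] by auto
      qed
      show "?L \<subseteq> (\<lambda>(a, b, c). a @ b @ c) ` ?S"
      proof
        fix xs assume "xs \<in> ?L"
        then obtain i k where "0 < k" "list_descents xs = {i, i + k}" "Q i k"
          and xs: "distinct xs" "set xs = {1..n}"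
          by (auto simp: permutations_of_set_def)
        then obtain a b c where abc: "xs = a @ b @ c" "length a = i" "length b = k" "drops a b" "drops b c"
          "sorted_wrt (<) a" "sorted_wrt (<) b" "sorted_wrt (<) c"
          using list_descents_pair_iff[of xs k i] by blast
        have "set (a @ b @ c) = {1..<1 + n}" using xs abc by auto
        then have "(a, b, c) \<in> splits 1 n" using abc xs by (simp add: splits_def)
        then have "(a, b, c) \<in> ?S" using abc \<open>Q i k\<close> by (simp add: splits_with_def)
        then show "xs \<in> (\<lambda>(a, b, c). a @ b @ c) ` ?S" using abc by force
      qed
    qed
  qed
  show ?thesis
    using bij_betw_same_card[OF 1] bij_betw_same_card[OF 2] by simp
qed

lemma card_2_iff_shift: "card A = 2 \<longleftrightarrow> (\<exists>i k. 0 < k \<and> A = {i, i + k})" for A :: "nat set"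
proof
  assume "card A = 2"
  then obtain x y where xy: "A = {x, y}" "x \<noteq> y" by (auto simp: card_2_iff)
  show "\<exists>i k. 0 < k \<and> A = {i, i + k}"
  proof (cases "x < y")
    case True
    then have "A = {x, x + (y - x)}" "0 < y - x" using xy by auto
    then show ?thesis by blast
  next
    case False
    then have "A = {y, y + (x - y)}" "0 < x - y" using xy by auto
    then show ?thesis by blast
  qed
next
  assume "\<exists>i k. 0 < k \<and> A = {i, i + k}"
  then show "card A = 2" by auto
qed

lemma eulerian_2: "int (eulerian n 2) = count_splits (\<lambda>x y z i j. x \<and> y) n"
proof -
  have "eulerian n 2 = card (splits_with (\<lambda>x y z i j. x \<and> y \<and> True) 1 n)"
    using card_two_descents[of n "\<lambda>i j. True"] by (simp add: eulerian_def card_2_iff_shift)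
  then show ?thesis by (simp add: card_splits_with)
qed

text \<open>Every position that is not a descent is an ascent, so the condition at \<open>l\<close>
  says that twice the number of descents up to \<open>l\<close> is at most \<open>l\<close>. The
  binding cases are the descents themselves, giving 2 <= i and 4 <= i + k.\<close>

lemma ballot_two_descents_iff:
  assumes \<pi>: "\<pi> permutes {1..n}" and D: "descents n \<pi> = {i, i + k}" and k: "0 < k"
  shows "ballot n \<pi> \<longleftrightarrow> i \<noteq> 1 \<and> \<not> (i = 2 \<and> k = 1)"
proof -
  have A: "ascents n \<pi> = {1..<n} - {i, i + k}"
  proof -
    have "\<pi> l \<noteq> \<pi> (l + 1)" for l
      using permutes_inj[OF \<pi>] by (metis add_cancel_right_right injD zero_neq_one)
    then have "ascents n \<pi> = {1..<n} - descents n \<pi>"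
      unfolding ascents_def descents_def by (auto simp: nat_neq_iff)
    then show ?thesis by (simp add: D)
  qed
  have "i \<in> descents n \<pi>" "i + k \<in> descents n \<pi>" using D by simp_all
  then have ik: "1 \<le> i" "i + k < n" by (simp_all add: descents_def)
  have *: "card (ascents n \<pi> \<inter> {1..l}) \<ge> card (descents n \<pi> \<inter> {1..l}) \<longleftrightarrow>
      2 * card ({i, i + k} \<inter> {1..l}) \<le> l" if "l \<in> {1..<n}" for l
  proof -
    have "ascents n \<pi> \<inter> {1..l} = {1..l} - {i, i + k} \<inter> {1..l}" unfolding A using that by auto
    then have "card (ascents n \<pi> \<inter> {1..l}) = l - card ({i, i + k} \<inter> {1..l})"
      by (simp add: card_Diff_subset)
    then show ?thesis unfolding D by linarith
  qed
  have c: "card ({i, i + k} \<inter> {1..l}) = (if l < i then 0 else if l < i + k then 1 else 2)" for l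
  proof -
    have "{i, i + k} \<inter> {1..l} = (if l < i then {} else if l < i + k then {i} else {i, i + k})"
      using ik k by auto
    then show ?thesis using k by auto
  qed
  have "ballot n \<pi> \<longleftrightarrow> (\<forall>l\<in>{1..<n}. 2 * card ({i, i + k} \<inter> {1..l}) \<le> l)"
    unfolding ballot_def using * by blast
  also have "\<dots> \<longleftrightarrow> (\<forall>l\<in>{1..<n}. 2 * (if l < i then 0 else if l < i + k then 1 else 2) \<le> l)"
    by (simp only: c)
  also have "\<dots> \<longleftrightarrow> 2 \<le> i \<and> 4 \<le> i + k"
  proof
    assume "\<forall>l\<in>{1..<n}. 2 * (if l < i then 0 else if l < i + k then 1 else 2) \<le> l"
    from bspec[OF this, of i] bspec[OF this, of "i + k"] show "2 \<le> i \<and> 4 \<le> i + k"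
      using ik k by auto
  qed auto
  \<comment> \<open>For positive i and k, the only failure of 4 <= i + k with 2 <= i is i = 2, k =
    1.\<close>
  also have "\<dots> \<longleftrightarrow> i \<noteq> 1 \<and> \<not> (i = 2 \<and> k = 1)" using ik k by auto
  finally show ?thesis .
qed

lemma ballot_number_2: "int (ballot_number n 2) = count_splits ballot_split n"
proof -
  have "ballot_number n 2 = card {\<pi>. \<pi> permutes {1..n} \<and>
     (\<exists>i k. 0 < k \<and> descents n \<pi> = {i, i + k} \<and> (i \<noteq> 1 \<and> \<not> (i = 2 \<and> k = 1)))}"
  proof -
    have "(\<pi> permutes {1..n} \<and> ballot n \<pi> \<and> card (descents n \<pi>) = 2) = (\<pi> permutes {1..n} \<and>
     (\<exists>i k. 0 < k \<and> descents n \<pi> = {i, i + k} \<and> (i \<noteq> 1 \<and> \<not> (i = 2 \<and> k = 1))))" for \<pi>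
      unfolding card_2_iff_shift using ballot_two_descents_iff[of \<pi> n] by metis
    then show ?thesis by (simp only: ballot_number_def)
  qed
  also have "\<dots> = card (splits_with (\<lambda>x y z i k. x \<and> y \<and> (i \<noteq> 1 \<and> \<not> (i = 2 \<and> k = 1))) 1 n)"
    by (rule card_two_descents)
  also have "\<dots> = card (splits_with ballot_split 1 n)"
    by (rule arg_cong[of _ _ "\<lambda>Q. card (splits_with Q 1 n)"]) (simp add: ballot_split_def fun_eq_iff)
  finally show ?thesis
    by (simp only: card_splits_with)
qed

section \<open>Permutations as sets of cycles\<close>

text \<open>The least entry comes first, to match the rotation chosen by
  \<open>perm_cycles\<close>.\<close>

definition is_cycle :: "nat \<Rightarrow> nat list \<Rightarrow> bool" where
  "is_cycle n c \<longleftrightarrow> c \<noteq> [] \<and> distinct c \<and> set c \<subseteq> {1..n} \<and> (\<forall>y\<in>set c. hd c \<le> y)"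

definition follows :: "(nat \<Rightarrow> nat) \<Rightarrow> nat list \<Rightarrow> bool" where
  "follows \<pi> c \<longleftrightarrow> (\<forall>i<length c. \<pi> (c ! i) = c ! (Suc i mod length c))"

lemma permutation_of_permutes: "\<pi> permutes {1..n :: nat} \<Longrightarrow> permutation \<pi>"
  unfolding permutation_permutes by blast

text \<open>Iterating \<pi> from the head walks cyclically through \<open>c\<close>, and
  distinctness makes the first return happen after exactly \<open>length c\<close> steps.\<close>

lemma support_eqI:
  assumes "c \<noteq> []" "distinct c" "follows \<pi> c"
  shows "support \<pi> (hd c) = c"
proof -
  have len: "0 < length c" using assms by simp
  have pow: "(\<pi> ^^ i) (hd c) = c ! (i mod length c)" for i
  proof (induction i)
    case 0
    then show ?case using assms by (simp add: hd_conv_nth)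
  next
    case (Suc i)
    have "\<pi> (c ! (i mod length c)) = c ! (Suc (i mod length c) mod length c)"
      using assms(3) len by (simp add: follows_def)
    then show ?case using Suc by (simp add: mod_Suc_eq)
  qed
  have "least_power \<pi> (hd c) = length c"
  proof (rule antisym)
    have root: "(\<pi> ^^ length c) (hd c) = hd c"
      unfolding pow using assms by (simp add: hd_conv_nth)
    show le: "least_power \<pi> (hd c) \<le> length c"
      using least_power_le[OF root len] .
    have "c ! (least_power \<pi> (hd c) mod length c) = c ! 0"
      using least_powerI(1)[OF root len] assms unfolding pow by (simp add: hd_conv_nth)
    then have "least_power \<pi> (hd c) mod length c = 0"
      using assms(2) len by (simp add: nth_eq_iff_index_eq)
    then show "length c \<le> least_power \<pi> (hd c)"
      using least_powerI(2)[OF root len] by (auto dest: dvd_imp_le)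
  qed
  then show ?thesis
    by (intro nth_equalityI) (simp_all add: pow)
qed

text \<open>Trades \<open>support\<close> and its least powers for two list conditions, in which
  cycles can be built, reversed and compared.\<close>

lemma perm_cycles_iff:
  assumes "\<pi> permutes {1..n}"
  shows "c \<in> perm_cycles n \<pi> \<longleftrightarrow> is_cycle n c \<and> follows \<pi> c"
proof
  note p = permutation_of_permutes[OF assms]
  assume "c \<in> perm_cycles n \<pi>"
  then obtain x where c: "c = support \<pi> x" and x: "x \<in> {1..n}" "\<forall>y\<in>set c. x \<le> y"
    unfolding perm_cycles_def by blast
  have len: "length c = least_power \<pi> x" "0 < length c"
    using least_power_of_permutation(2)[OF p] by (simp_all add: c)
  have nth: "c ! i = (\<pi> ^^ i) x" if "i < length c" for i using that by (simp add: c)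
  have "hd c = x" using len(2) nth[of 0] by (cases c) auto
  moreover have "set c \<subseteq> {1..n}"
    using x(1) permutes_in_image[OF permutes_funpow[OF assms]] by (auto simp: c simp del: atLeastAtMost_iff)
  ultimately have "is_cycle n c"
    using x len cycle_of_permutation[OF p, of x] by (auto simp: is_cycle_def c)
  moreover have "follows \<pi> c"
    unfolding follows_def
  proof (intro allI impI)
    fix i assume i: "i < length c"
    show "\<pi> (c ! i) = c ! (Suc i mod length c)"
    proof (cases "Suc i = length c")
      case True
      then have "\<pi> (c ! i) = (\<pi> ^^ least_power \<pi> x) x" using nth[OF i] len by (metis comp_apply funpow.simps(2))
      then show ?thesis using True nth[of 0] len least_power_of_permutation(1)[OF p] by simp
    next
      case False
      then show ?thesis using i nth[of i] nth[of "Suc i"] by simp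
    qed
  qed
  ultimately show "is_cycle n c \<and> follows \<pi> c" by blast
next
  assume "is_cycle n c \<and> follows \<pi> c"
  then have c: "c \<noteq> []" "distinct c" "follows \<pi> c" "set c \<subseteq> {1..n}" "\<forall>y\<in>set c. hd c \<le> y"
    by (simp_all add: is_cycle_def)
  have *: "c = support \<pi> (hd c)" using support_eqI[OF c(1-3)] by simp
  have "hd c \<in> {1..n}" using hd_in_set[OF c(1)] c(4) by blast
  moreover have "\<forall>y\<in>set (support \<pi> (hd c)). hd c \<le> y" using c(5) by (simp only: *[symmetric])
  ultimately have "support \<pi> (hd c) \<in> perm_cycles n \<pi>" unfolding perm_cycles_def by blast
  then show "c \<in> perm_cycles n \<pi>" by (simp only: *[symmetric])
qed

lemma perm_cycles_cover:
  assumes "\<pi> permutes {1..n}" "x \<in> {1..n}"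
  obtains c where "c \<in> perm_cycles n \<pi>" "x \<in> set c"
proof -
  note p = permutation_of_permutes[OF assms(1)]
  \<comment> \<open>Restarting the cycle at its minimum yields the representative that
    \<open>perm_cycles\<close> keeps.\<close>
  define m where "m = Min (set (support \<pi> x))"
  have ne: "set (support \<pi> y) \<noteq> {}" for y using least_power_of_permutation(2)[OF p] by simp
  have self: "y \<in> set (support \<pi> y)" for y
    unfolding support_set[OF p] by (metis funpow_0 rangeI)
  have m: "m \<in> set (support \<pi> x)" unfolding m_def by (rule Min_in) (use ne in auto)
  then have "set (support \<pi> m) \<inter> set (support \<pi> x) \<noteq> {}" using self by blast
  then have eq: "set (support \<pi> m) = set (support \<pi> x)"
    using disjoint_support[OF p] by (meson disjoint_def rangeI)
  have "\<forall>y\<in>set (support \<pi> m). m \<le> y" unfolding eq unfolding m_def by simp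
  moreover have "m \<in> {1..n}"
    using m assms(2) permutes_in_image[OF permutes_funpow[OF assms(1)]] by (auto simp del: atLeastAtMost_iff)
  ultimately have "support \<pi> m \<in> perm_cycles n \<pi>" unfolding perm_cycles_def by blast
  moreover have "x \<in> set (support \<pi> m)" using eq self by blast
  ultimately show ?thesis by (rule that)
qed

lemma perm_cycles_disjoint:
  assumes "\<pi> permutes {1..n}" "c \<in> perm_cycles n \<pi>" "d \<in> perm_cycles n \<pi>" "x \<in> set c" "x \<in> set d"
  shows "c = d"
proof -
  note p = permutation_of_permutes[OF assms(1)]
  obtain y z where c: "c = support \<pi> y" "\<forall>w\<in>set c. y \<le> w" and d: "d = support \<pi> z" "\<forall>w\<in>set d. z \<le> w"
    using assms(2,3) unfolding perm_cycles_def by blast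
  have "set c \<inter> set d \<noteq> {}" using assms by blast
  then have eq: "set c = set d"
    unfolding c(1) d(1) using disjoint_support[OF p] by (meson disjoint_def rangeI)
  have self: "y \<in> set (support \<pi> y)" for y
    unfolding support_set[OF p] by (metis funpow_0 rangeI)
  have "y \<in> set c" "z \<in> set d" using self unfolding c(1) d(1) by blast+
  then have "y = z" using eq c(2) d(2) by (simp add: antisym)
  then show ?thesis using c d by simp
qed

lemma finite_perm_cycles: "finite (perm_cycles n \<pi>)"
proof -
  have "perm_cycles n \<pi> \<subseteq> support \<pi> ` {1..n}" unfolding perm_cycles_def by blast
  then show ?thesis by (rule finite_subset) simp
qed

text \<open>Fixed points are odd cycles with \<open>cycle_M\<close> 0, so both the parity condition
  and \<open>perm_M\<close> can be read off the remaining cycles.\<close>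

definition long_cycles :: "nat \<Rightarrow> (nat \<Rightarrow> nat) \<Rightarrow> nat list set" where
  "long_cycles n \<pi> = {c \<in> perm_cycles n \<pi>. 2 \<le> length c}"

lemma fixed_if_no_long_cycle:
  assumes "\<pi> permutes {1..n}" "\<forall>c\<in>long_cycles n \<pi>. x \<notin> set c"
  shows "\<pi> x = x"
proof (cases "x \<in> {1..n}")
  case True
  then obtain c where c: "c \<in> perm_cycles n \<pi>" "x \<in> set c" by (rule perm_cycles_cover[OF assms(1)])
  then have "length c < 2" using assms(2) by (auto simp: long_cycles_def)
  with c(2) have "c = [x]" by (cases c; cases "tl c") auto
  then show ?thesis using c(1) by (simp add: perm_cycles_iff[OF assms(1)] follows_def)
qed (rule permutes_not_in[OF assms(1)])

lemma follows_unique: "follows \<pi> c \<Longrightarrow> follows \<sigma> c \<Longrightarrow> x \<in> set c \<Longrightarrow> \<pi> x = \<sigma> x"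
  by (auto simp: follows_def in_set_conv_nth)

text \<open>A permutation is prescribed on its long cycles and fixes every other point.\<close>

lemma inj_on_long_cycles: "inj_on (long_cycles n) {\<pi>. \<pi> permutes {1..n}}"
proof (rule inj_onI, rule ext)
  fix \<pi> \<sigma> x assume *: "\<pi> \<in> {\<pi>. \<pi> permutes {1..n}}" "\<sigma> \<in> {\<pi>. \<pi> permutes {1..n}}" "long_cycles n \<pi> = long_cycles n \<sigma>"
  then have p: "\<pi> permutes {1..n}" "\<sigma> permutes {1..n}" by auto
  show "\<pi> x = \<sigma> x"
  proof (cases "\<exists>c\<in>long_cycles n \<pi>. x \<in> set c")
    case True
    then obtain c where "c \<in> long_cycles n \<pi>" "c \<in> long_cycles n \<sigma>" "x \<in> set c" using * by auto
    then show ?thesis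
      unfolding long_cycles_def by (auto simp: perm_cycles_iff[OF p(1)] perm_cycles_iff[OF p(2)] intro: follows_unique)
  next
    case False
    then show ?thesis using fixed_if_no_long_cycle[OF p(1)] fixed_if_no_long_cycle[OF p(2)] * by metis
  qed
qed

text \<open>A long cycle moves its head, which therefore lies in some member of \<open>S\<close>;
  cycles sharing a point coincide.\<close>

lemma long_cycles_eqI:
  assumes "\<pi> permutes {1..n}" "\<forall>c\<in>S. is_cycle n c \<and> follows \<pi> c \<and> 2 \<le> length c"
    and "\<And>x. x \<notin> (\<Union>c\<in>S. set c) \<Longrightarrow> \<pi> x = x"
  shows "long_cycles n \<pi> = S"
proof
  show S: "S \<subseteq> long_cycles n \<pi>"
    using assms(2) by (auto simp: long_cycles_def perm_cycles_iff[OF assms(1)])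
  show "long_cycles n \<pi> \<subseteq> S"
  proof
    fix e assume e: "e \<in> long_cycles n \<pi>"
    then have *: "distinct e" "follows \<pi> e" "2 \<le> length e" "e \<in> perm_cycles n \<pi>"
      by (auto simp: long_cycles_def perm_cycles_iff[OF assms(1)] is_cycle_def)
    then have "\<pi> (e ! 0) = e ! 1" unfolding follows_def by (metis One_nat_def Suc_1 Suc_le_lessD mod_less less_le_trans zero_less_numeral)
    then have "\<pi> (e ! 0) \<noteq> e ! 0" using *(3) nth_eq_iff_index_eq[OF *(1), of 1 0] by fastforce
    then obtain c where c: "c \<in> S" "e ! 0 \<in> set c" using assms(3) by blast
    moreover have "e ! 0 \<in> set e" using * by (intro nth_mem) linarith
    moreover have "c \<in> perm_cycles n \<pi>" using S c by (auto simp: long_cycles_def)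
    ultimately have "c = e" using perm_cycles_disjoint[OF assms(1)] * by blast
    then show "e \<in> S" using c by simp
  qed
qed

lemma follows_cycle_of_list: "distinct c \<Longrightarrow> follows (cycle_of_list c) c"
proof -
  assume "distinct c"
  then have "map (cycle_of_list c) c = rotate1 c"
    using cyclic_rotation[of c 1] by simp
  then show ?thesis unfolding follows_def by (metis nth_map nth_rotate1)
qed

lemma ex_long_cycles_pair:
  assumes "is_cycle n c" "is_cycle n d" "2 \<le> length c" "2 \<le> length d" "set c \<inter> set d = {}"
  shows "\<exists>\<pi>. \<pi> permutes {1..n} \<and> long_cycles n \<pi> = {c, d}"
proof (intro exI conjI)
  \<comment> \<open>The cycles are disjoint, so each factor fixes what the other moves and the
    product follows both.\<close>
  let ?\<pi> = "cycle_of_list c \<circ> cycle_of_list d"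
  have dist: "distinct c" "distinct d" "set c \<subseteq> {1..n}" "set d \<subseteq> {1..n}" using assms by (auto simp: is_cycle_def)
  show p: "?\<pi> permutes {1..n}"
    using dist by (intro permutes_compose permutes_subset[OF cycle_permutes])
  have fc: "follows ?\<pi> c"
    using follows_cycle_of_list[OF dist(1)] assms(5) id_outside_supp[of _ d]
    by (auto simp: follows_def disjoint_iff)
  have fd: "follows ?\<pi> d"
  proof -
    have "d ! (Suc i mod length d) \<notin> set c" if "i < length d" for i
    proof -
      have "Suc i mod length d < length d" using that by (intro mod_less_divisor) auto
      then show ?thesis using assms(5) nth_mem by blast
    qed
    then show ?thesis
      using follows_cycle_of_list[OF dist(2)] id_outside_supp[of _ c] by (auto simp: follows_def)
  qed
  show "long_cycles n ?\<pi> = {c, d}"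
    by (rule long_cycles_eqI[OF p]) (use fc fd assms in \<open>auto simp: id_outside_supp\<close>)
qed

lemma ex_long_cycles_single:
  assumes "is_cycle n c" "2 \<le> length c"
  shows "\<exists>\<pi>. \<pi> permutes {1..n} \<and> long_cycles n \<pi> = {c}"
proof (intro exI conjI)
  have dist: "distinct c" "set c \<subseteq> {1..n}" using assms by (auto simp: is_cycle_def)
  show p: "cycle_of_list c permutes {1..n}"
    using dist by (intro permutes_subset[OF cycle_permutes])
  show "long_cycles n (cycle_of_list c) = {c}"
    by (rule long_cycles_eqI[OF p]) (use follows_cycle_of_list[OF dist(1)] assms in \<open>auto simp: id_outside_supp\<close>)
qed

section \<open>Cyclic ascents and descents, and odd cycles with prescribed M\<close>

lemma cA_add_cD: "cA c + cD c = length c"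
proof -
  have "{..<length c} = {i \<in> {..<length c}. c ! i \<le> c ! (Suc i mod length c)} \<union>
      {i \<in> {..<length c}. c ! i > c ! (Suc i mod length c)}" by auto
  then have "length c = card ({i \<in> {..<length c}. c ! i \<le> c ! (Suc i mod length c)} \<union>
      {i \<in> {..<length c}. c ! i > c ! (Suc i mod length c)})" by (metis card_lessThan)
  also have "\<dots> = cA c + cD c" unfolding cA_def cD_def by (rule card_Un_disjoint) auto
  finally show ?thesis by simp
qed

text \<open>The head is least, so the step from the last entry back to it always descends; this is
  the extra 1.\<close>

lemma cD_eq_list_descents:
  assumes "is_cycle n c" "2 \<le> length c"
  shows "cD c = Suc (card (list_descents c))"
proof -
  let ?l = "length c - 1"
  have c: "c \<noteq> []" "distinct c" "\<forall>y\<in>set c. hd c \<le> y" using assms(1) by (auto simp: is_cycle_def)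
  have last: "c ! 0 < c ! ?l"
  proof -
    have "c ! 0 \<noteq> c ! ?l" using nth_eq_iff_index_eq[OF c(2), of 0 ?l] assms(2) c(1) by auto
    moreover have "c ! 0 \<le> c ! ?l" using c assms(2) by (simp add: hd_conv_nth)
    ultimately show ?thesis by simp
  qed
  \<comment> \<open>\<open>cD\<close> indexes a descent by its upper entry,
    \<open>list_descents\<close> by its lower one; hence the shift by \<open>Suc\<close>.\<close>
  have "{i \<in> {..<length c}. c ! i > c ! (Suc i mod length c)} = insert ?l {i. Suc i \<in> list_descents c}"
    (is "?A = ?B")
  proof (rule set_eqI)
    fix i
    consider "i = ?l" | "Suc i < length c" | "length c \<le> i" by linarith
    then show "i \<in> ?A \<longleftrightarrow> i \<in> ?B"
    proof cases
      case 1
      then have "Suc i = length c" using assms(2) by linarith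
      then have "Suc i mod length c = 0" "i < length c" by auto
      then show ?thesis using last 1 by simp
    next
      case 2
      then show ?thesis by (auto simp: list_descents_def)
    next
      case 3
      then show ?thesis using assms(2) by (auto simp: list_descents_def)
    qed
  qed
  then have "cD c = card (insert ?l {i. Suc i \<in> list_descents c})" by (simp add: cD_def)
  also have "\<dots> = Suc (card {i. Suc i \<in> list_descents c})"
  proof (rule card_insert_disjoint)
    have "{i. Suc i \<in> list_descents c} \<subseteq> {..<length c}" by (auto simp: list_descents_def)
    then show "finite {i. Suc i \<in> list_descents c}" by (rule finite_subset) simp
  qed (auto simp: list_descents_def)
  also have "card {i. Suc i \<in> list_descents c} = card (list_descents c)"
  proof (rule bij_betw_same_card[of Suc], rule bij_betw_imageI)
    show "Suc ` {i. Suc i \<in> list_descents c} = list_descents c"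
    proof -
      have "j \<in> Suc ` {i. Suc i \<in> list_descents c}" if "j \<in> list_descents c" for j
        using that by (cases j) (auto simp: list_descents_def)
      then show ?thesis by auto
    qed
  qed simp
  finally show ?thesis .
qed

text \<open>The step leaving the least entry ascends and the step returning to it descends.\<close>

lemma cycle_M_pos:
  assumes "is_cycle n c" "2 \<le> length c"
  shows "0 < cycle_M c"
proof -
  have "c ! 0 \<le> c ! 1" using assms unfolding is_cycle_def by (metis One_nat_def Suc_1 Suc_le_lessD hd_conv_nth nth_mem)
  then have "0 \<in> {i \<in> {..<length c}. c ! i \<le> c ! (Suc i mod length c)}" using assms(2) by auto
  then have "cA c \<noteq> 0" unfolding cA_def by (subst card_0_eq) auto
  then show ?thesis using cD_eq_list_descents[OF assms] by (simp add: cycle_M_def)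
qed

definition odd_cycles :: "nat \<Rightarrow> nat \<Rightarrow> nat list set" where
  "odd_cycles n m = {c. is_cycle n c \<and> odd (length c) \<and> cycle_M c = m}"

lemma cycle_M_short: "length c < 2 \<Longrightarrow> cycle_M c = 0"
proof -
  assume "length c < 2"
  then have "{i \<in> {..<length c}. c ! i > c ! (Suc i mod length c)} = {}" by (auto simp: less_2_cases_iff)
  then show ?thesis by (simp add: cycle_M_def cD_def del: Collect_empty_eq)
qed

lemma odd_cycles_length: "c \<in> odd_cycles n m \<Longrightarrow> 0 < m \<Longrightarrow> 3 \<le> length c"
  using cycle_M_short[of c] by (cases "length c < 2") (auto simp: odd_cycles_def, presburger)

lemma finite_odd_cycles: "finite (odd_cycles n m)"
proof (rule finite_subset)
  show "odd_cycles n m \<subseteq> {c. set c \<subseteq> {1..n} \<and> distinct c}"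
    by (auto simp: odd_cycles_def is_cycle_def)
qed (simp add: finite_subset_distinct)

text \<open>Comparing heads selects one order for each unordered pair of disjoint cycles.\<close>

definition cycle_pairs :: "nat list set \<Rightarrow> (nat list \<times> nat list) set" where
  "cycle_pairs K = {(c, d). c \<in> K \<and> d \<in> K \<and> set c \<inter> set d = {} \<and> hd c < hd d}"

text \<open>Each long cycle contributes at least 1 to a sum equal to 2, so there is one contributing
  2 or there are two contributing 1 each.\<close>

lemma odd_and_M_iff:
  assumes "\<pi> permutes {1..n}"
  shows "(\<forall>c\<in>perm_cycles n \<pi>. odd (length c)) \<and> perm_M n \<pi> = 2 \<longleftrightarrow>
    (\<exists>c\<in>odd_cycles n 2. long_cycles n \<pi> = {c}) \<or>
    (\<exists>(c, d)\<in>cycle_pairs (odd_cycles n 1). long_cycles n \<pi> = {c, d})" (is "?L \<longleftrightarrow> ?R")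
proof -
  let ?C = "long_cycles n \<pi>"
  have fin: "finite ?C" using finite_perm_cycles by (simp add: long_cycles_def)
  have cyc: "is_cycle n c \<and> follows \<pi> c \<and> 2 \<le> length c" if "c \<in> ?C" for c
    using that by (simp add: long_cycles_def perm_cycles_iff[OF assms])
  have "2 \<le> length c" if "cycle_M c \<noteq> 0" for c using that cycle_M_short[of c] by linarith
  then have M: "perm_M n \<pi> = sum cycle_M ?C"
    unfolding perm_M_def long_cycles_def
    by (intro sum.mono_neutral_right) (auto simp: finite_perm_cycles)
  have odd: "(\<forall>c\<in>perm_cycles n \<pi>. odd (length c)) \<longleftrightarrow> (\<forall>c\<in>?C. odd (length c))"
  proof -
    have "odd (length c)" if "c \<in> perm_cycles n \<pi>" "\<not> 2 \<le> length c" for c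
    proof -
      have "c \<noteq> []" using that by (simp add: perm_cycles_iff[OF assms] is_cycle_def)
      then have "0 < length c" by simp
      then have "length c = 1" using that(2) by linarith
      then show ?thesis by simp
    qed
    then show ?thesis by (auto simp: long_cycles_def)
  qed
  show ?thesis
  proof
    assume L: ?L
    then have sum: "sum cycle_M ?C = 2" and odd: "\<forall>c\<in>?C. odd (length c)" using M odd by auto
    then have "?C \<noteq> {}" by auto
    then obtain c where c: "c \<in> ?C" by blast
    have sum_c: "cycle_M c + sum cycle_M (?C - {c}) = 2" using sum sum.remove[OF fin c, of cycle_M] by linarith
    have pos: "0 < cycle_M c" if "c \<in> ?C" for c using cycle_M_pos cyc[OF that] by blast
    show ?R
    proof (cases "?C = {c}")
      case True
      then have "c \<in> odd_cycles n 2" using sum odd cyc[OF c] by (simp add: odd_cycles_def)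
      then show ?thesis using True by blast
    next
      case False
      then obtain d where d: "d \<in> ?C" "d \<noteq> c" using c by blast
      have sum_d: "cycle_M d + sum cycle_M (?C - {c} - {d}) = sum cycle_M (?C - {c})"
        using sum.remove[of "?C - {c}" d cycle_M] fin d by simp
      then have M1: "cycle_M c = 1" "cycle_M d = 1" "sum cycle_M (?C - {c} - {d}) = 0"
        using sum_c pos[OF c] pos[OF d(1)] by linarith+
      have "\<forall>e\<in>?C - {c} - {d}. cycle_M e = 0" using M1(3) fin by simp
      then have "?C - {c} - {d} = {}" using pos by (metis DiffD1 all_not_in_conv less_irrefl)
      then have C: "?C = {c, d}" using c d by blast
      have K: "c \<in> odd_cycles n 1" "d \<in> odd_cycles n 1" using M1 odd c d cyc by (auto simp: odd_cycles_def)
      have disj: "set c \<inter> set d = {}"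
        using perm_cycles_disjoint[OF assms, of c d] c d by (auto simp: long_cycles_def)
      have "c \<noteq> []" "d \<noteq> []" using cyc[OF c] cyc[OF d(1)] by auto
      then have "hd c \<noteq> hd d" using disj hd_in_set by (metis disjoint_iff)
      then consider "hd c < hd d" | "hd d < hd c" by linarith
      then show ?thesis
      proof cases
        case 1
        then have "(c, d) \<in> cycle_pairs (odd_cycles n 1)" using K disj by (simp add: cycle_pairs_def)
        then show ?thesis using C by blast
      next
        case 2
        then have "(d, c) \<in> cycle_pairs (odd_cycles n 1)" using K disj by (auto simp: cycle_pairs_def)
        moreover have "?C = {d, c}" using C by blast
        ultimately show ?thesis by blast
      qed
    qed
  next
    assume ?R
    then show ?L
    proof
      assume "\<exists>c\<in>odd_cycles n 2. ?C = {c}"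
      then obtain c where "c \<in> odd_cycles n 2" "?C = {c}" by blast
      then show ?L unfolding M odd by (simp add: odd_cycles_def)
    next
      assume "\<exists>(c, d)\<in>cycle_pairs (odd_cycles n 1). ?C = {c, d}"
      then obtain c d where cd: "c \<in> odd_cycles n 1" "d \<in> odd_cycles n 1" "hd c < hd d" "?C = {c, d}"
        by (auto simp: cycle_pairs_def)
      then have "c \<noteq> d" by auto
      then show ?L unfolding M odd using cd by (simp add: odd_cycles_def)
    qed
  qed
qed

text \<open>\<open>long_cycles\<close> is injective on permutations, so its image can be counted
  instead: it consists of singletons and genuine pairs, each realised by a product of the given
  cycles.\<close>

lemma odd_cycle_number_2:
  "odd_cycle_number n 2 = card (odd_cycles n 2) + card (cycle_pairs (odd_cycles n 1))"
proof -
  let ?P = "cycle_pairs (odd_cycles n 1)"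
  let ?X = "{\<pi>. \<pi> permutes {1..n} \<and> (\<forall>c\<in>perm_cycles n \<pi>. odd (length c)) \<and> perm_M n \<pi> = 2}"
  have X: "?X = {\<pi>. \<pi> permutes {1..n} \<and> ((\<exists>c\<in>odd_cycles n 2. long_cycles n \<pi> = {c}) \<or>
      (\<exists>(c, d)\<in>?P. long_cycles n \<pi> = {c, d}))}"
    using odd_and_M_iff by blast
  have img: "long_cycles n ` ?X = (\<lambda>c. {c}) ` odd_cycles n 2 \<union> (\<lambda>(c, d). {c, d}) ` ?P" (is "_ = ?R")
  proof
    show "long_cycles n ` ?X \<subseteq> ?R" unfolding X by auto
    show "?R \<subseteq> long_cycles n ` ?X"
    proof
      fix S assume "S \<in> ?R"
      then have "\<exists>\<pi>. \<pi> permutes {1..n} \<and> long_cycles n \<pi> = S \<and> ((\<exists>c\<in>odd_cycles n 2. S = {c}) \<or>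
          (\<exists>(c, d)\<in>?P. S = {c, d}))"
      proof
        assume "S \<in> (\<lambda>c. {c}) ` odd_cycles n 2"
        then obtain c where c: "c \<in> odd_cycles n 2" "S = {c}" by blast
        have "is_cycle n c" "2 \<le> length c" using odd_cycles_length[OF c(1)] c(1) by (auto simp: odd_cycles_def)
        from ex_long_cycles_single[OF this] show ?thesis using c by blast
      next
        assume "S \<in> (\<lambda>(c, d). {c, d}) ` ?P"
        then obtain c d where cd: "(c, d) \<in> ?P" "S = {c, d}" by auto
        have "is_cycle n c" "2 \<le> length c" "is_cycle n d" "2 \<le> length d" "set c \<inter> set d = {}"
          using odd_cycles_length[of c n 1] odd_cycles_length[of d n 1] cd(1)
          by (auto simp: cycle_pairs_def odd_cycles_def)
        from ex_long_cycles_pair[OF this(1,3,2,4,5)] show ?thesis using cd by blast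
      qed
      then show "S \<in> long_cycles n ` ?X" unfolding X by blast
    qed
  qed
  have "inj_on (long_cycles n) ?X"
    by (rule inj_on_subset[OF inj_on_long_cycles]) auto
  from card_image[OF this] have "card ?X = card ?R" unfolding img by (rule sym)
  also have "\<dots> = card ((\<lambda>c. {c}) ` odd_cycles n 2) + card ((\<lambda>(c, d). {c, d}) ` ?P)"
  proof (rule card_Un_disjoint)
    show "finite ((\<lambda>c. {c}) ` odd_cycles n 2)" by (simp add: finite_odd_cycles)
    have "?P \<subseteq> odd_cycles n 1 \<times> odd_cycles n 1" by (auto simp: cycle_pairs_def)
    then have "finite ?P" by (rule finite_subset) (simp add: finite_odd_cycles)
    then show "finite ((\<lambda>(c, d). {c, d}) ` ?P)" by simp
    show "(\<lambda>c. {c}) ` odd_cycles n 2 \<inter> (\<lambda>(c, d). {c, d}) ` ?P = {}"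
      by (auto simp: cycle_pairs_def)
  qed
  also have "card ((\<lambda>c. {c}) ` odd_cycles n 2) = card (odd_cycles n 2)"
    by (simp add: card_image)
  also have "card ((\<lambda>(c, d). {c, d}) ` ?P) = card ?P"
    by (rule card_image) (auto simp: inj_on_def cycle_pairs_def doubleton_eq_iff)
  finally show ?thesis by (simp add: odd_cycle_number_def)
qed

section \<open>Odd cycles with one or two descents\<close>

text \<open>This is the inverse cycle; leaving the head in place keeps the rotation
  canonical.\<close>

definition reverse_cycle :: "nat list \<Rightarrow> nat list" where
  "reverse_cycle c = hd c # rev (tl c)"

lemma reverse_cycle_simps [simp]:
  assumes "c \<noteq> []"
  shows "length (reverse_cycle c) = length c" "set (reverse_cycle c) = set c"
    "hd (reverse_cycle c) = hd c" "reverse_cycle (reverse_cycle c) = c"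
    "distinct (reverse_cycle c) = distinct c"
  using assms by (cases c; auto simp: reverse_cycle_def)+

lemma reverse_cycle_nonempty [simp]: "reverse_cycle c \<noteq> []"
  by (simp add: reverse_cycle_def)

lemma is_cycle_reverse_cycle: "is_cycle n c \<Longrightarrow> is_cycle n (reverse_cycle c)"
  by (simp add: is_cycle_def)

lemma reverse_cycle_nth:
  assumes "i < length c"
  shows "reverse_cycle c ! i = c ! ((length c - i) mod length c)"
proof (cases i)
  case 0
  then show ?thesis using assms by (cases c) (auto simp: reverse_cycle_def)
next
  case (Suc j)
  then show ?thesis using assms by (cases c) (auto simp: reverse_cycle_def rev_nth nth_Cons')
qed

lemma cD_reverse_cycle:
  assumes "is_cycle n c" "2 \<le> length c"
  shows "cD (reverse_cycle c) = cA c"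
proof -
  let ?l = "length c"
  let ?D = "{i \<in> {..<?l}. reverse_cycle c ! i > reverse_cycle c ! (Suc i mod ?l)}"
  let ?A = "{i \<in> {..<?l}. c ! i \<le> c ! (Suc i mod ?l)}"
  have c: "c \<noteq> []" "distinct c" using assms by (auto simp: is_cycle_def)
  \<comment> \<open>Step \<open>i\<close> of the reversed cycle is step \<open>?l - 1 - i\<close> of
    \<open>c\<close> run backwards. The weak ascent counted by \<open>cA\<close> is strict here,
    because neighbours in a distinct list of length at least 2 differ.\<close>
  have step: "reverse_cycle c ! (Suc i mod ?l) < reverse_cycle c ! i \<longleftrightarrow>
      c ! (?l - 1 - i) \<le> c ! (Suc (?l - 1 - i) mod ?l)" if i: "i < ?l" for i
  proof -
    have 1: "reverse_cycle c ! i = c ! (Suc (?l - 1 - i) mod ?l)"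
      using reverse_cycle_nth[OF i] i by (simp add: Suc_diff_Suc)
    have 2: "reverse_cycle c ! (Suc i mod ?l) = c ! (?l - 1 - i)"
    proof (cases "Suc i = ?l")
      case True
      then show ?thesis using reverse_cycle_nth[of 0 c] i by fastforce
    next
      case False
      then show ?thesis using reverse_cycle_nth[of "Suc i" c] i by simp
    qed
    have "?l - 1 - i \<noteq> Suc (?l - 1 - i) mod ?l"
      using i assms(2) by (cases "i = 0") (auto simp: Suc_diff_Suc)
    moreover have "Suc (?l - 1 - i) mod ?l < ?l" using i by (intro mod_less_divisor) auto
    ultimately have "c ! (?l - 1 - i) \<noteq> c ! (Suc (?l - 1 - i) mod ?l)"
      using nth_eq_iff_index_eq[OF c(2)] i by simp
    then show ?thesis unfolding 1 2 by linarith
  qed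
  have "bij_betw (\<lambda>i. ?l - 1 - i) {..<?l} {..<?l}"
    by (rule bij_betw_byWitness[of _ "\<lambda>i. ?l - 1 - i"]) auto
  then have "bij_betw (\<lambda>i. ?l - 1 - i) ?D ?A"
    by (rule bij_betw_Collect) (use step in simp)
  then show ?thesis
    using c by (simp add: cD_def cA_def bij_betw_same_card)
qed

lemma cycle_M_reverse_cycle:
  assumes "is_cycle n c" "2 \<le> length c"
  shows "cycle_M (reverse_cycle c) = cycle_M c"
proof -
  have "c \<noteq> []" using assms(2) by auto
  then show ?thesis
    using cD_reverse_cycle[OF assms] cA_add_cD[of c] cA_add_cD[of "reverse_cycle c"]
    unfolding cycle_M_def by simp
qed

definition increasing_cycles :: "nat \<Rightarrow> nat list set" where
  "increasing_cycles n = {c. is_cycle n c \<and> odd (length c) \<and> 3 \<le> length c \<and> cD c = 1}"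

text \<open>One of the two cyclic descents is the return to the head, so the list has one inner
  descent and consists of two increasing runs.\<close>

definition two_run_cycles :: "nat \<Rightarrow> nat list set" where
  "two_run_cycles n = {c. is_cycle n c \<and> odd (length c) \<and> 5 \<le> length c \<and> cD c = 2}"

lemma odd_cycles_1: "odd_cycles n 1 = increasing_cycles n \<union> reverse_cycle ` increasing_cycles n"
proof
  show "odd_cycles n 1 \<subseteq> increasing_cycles n \<union> reverse_cycle ` increasing_cycles n"
  proof
    fix c assume c: "c \<in> odd_cycles n 1"
    then have *: "is_cycle n c" "3 \<le> length c" "odd (length c)" "c \<noteq> []" "min (cA c) (cD c) = 1"
      using odd_cycles_length[OF c] by (auto simp: odd_cycles_def cycle_M_def)
    then consider "cD c = 1" | "cA c = 1" by linarith
    then show "c \<in> increasing_cycles n \<union> reverse_cycle ` increasing_cycles n"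
    proof cases
      case 1
      then show ?thesis using * by (simp add: increasing_cycles_def)
    next
      case 2
      then have "reverse_cycle c \<in> increasing_cycles n"
        using * cD_reverse_cycle[of n c] by (simp add: increasing_cycles_def is_cycle_reverse_cycle)
      then show ?thesis using * by (metis UnI2 imageI reverse_cycle_simps(4))
    qed
  qed
  have "c \<in> odd_cycles n 1 \<and> reverse_cycle c \<in> odd_cycles n 1" if "c \<in> increasing_cycles n" for c
  proof -
    have *: "is_cycle n c" "odd (length c)" "3 \<le> length c" "cD c = 1" "c \<noteq> []"
      using that by (auto simp: increasing_cycles_def)
    then have "cycle_M c = 1" using cA_add_cD[of c] by (simp add: cycle_M_def)
    then show ?thesis
      using * cycle_M_reverse_cycle[of n c] by (simp add: odd_cycles_def is_cycle_reverse_cycle)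
  qed
  then show "increasing_cycles n \<union> reverse_cycle ` increasing_cycles n \<subseteq> odd_cycles n 1" by blast
qed

lemma odd_cycles_2: "odd_cycles n 2 = two_run_cycles n \<union> reverse_cycle ` two_run_cycles n"
proof
  show "odd_cycles n 2 \<subseteq> two_run_cycles n \<union> reverse_cycle ` two_run_cycles n"
  proof
    fix c assume c: "c \<in> odd_cycles n 2"
    then have *: "is_cycle n c" "odd (length c)" "3 \<le> length c" "c \<noteq> []" "min (cA c) (cD c) = 2"
      using odd_cycles_length[OF c] by (auto simp: odd_cycles_def cycle_M_def)
    \<comment> \<open>\<open>cA\<close> and \<open>cD\<close> are both at least 2; oddness then
      raises the bound on their sum from 4 to 5.\<close>
    then have "4 \<le> length c" using cA_add_cD[of c] by linarith
    then have 5: "5 \<le> length c" using *(2) by presburger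
    consider "cD c = 2" | "cA c = 2" using * by linarith
    then show "c \<in> two_run_cycles n \<union> reverse_cycle ` two_run_cycles n"
    proof cases
      case 1
      then show ?thesis using * 5 by (simp add: two_run_cycles_def)
    next
      case 2
      then have "reverse_cycle c \<in> two_run_cycles n"
        using * 5 cD_reverse_cycle[of n c] by (simp add: two_run_cycles_def is_cycle_reverse_cycle)
      then show ?thesis using * by (metis UnI2 imageI reverse_cycle_simps(4))
    qed
  qed
  have "c \<in> odd_cycles n 2 \<and> reverse_cycle c \<in> odd_cycles n 2" if "c \<in> two_run_cycles n" for c
  proof -
    have *: "is_cycle n c" "odd (length c)" "5 \<le> length c" "cD c = 2" "c \<noteq> []"
      using that by (auto simp: two_run_cycles_def)
    then have "cycle_M c = 2" using cA_add_cD[of c] by (simp add: cycle_M_def)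
    then show ?thesis
      using * cycle_M_reverse_cycle[of n c] by (simp add: odd_cycles_def is_cycle_reverse_cycle)
  qed
  then show "two_run_cycles n \<union> reverse_cycle ` two_run_cycles n \<subseteq> odd_cycles n 2" by blast
qed

lemma inj_on_reverse_cycle: "inj_on reverse_cycle {c. c \<noteq> []}"
  by (rule inj_onI) (metis mem_Collect_eq reverse_cycle_simps(4))

lemma card_odd_cycles_2: "card (odd_cycles n 2) = 2 * card (two_run_cycles n)"
proof -
  have fin: "finite (two_run_cycles n)"
    using finite_odd_cycles[of n 2] by (simp add: odd_cycles_2)
  \<comment> \<open>Length at least 5 with \<open>cD\<close> equal to 2 leaves \<open>cA\<close> at
    least 3, so the reversal has more than two cyclic descents.\<close>
  have "two_run_cycles n \<inter> reverse_cycle ` two_run_cycles n = {}"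
  proof -
    have "cD (reverse_cycle c) \<noteq> 2" if "c \<in> two_run_cycles n" for c
    proof -
      have "cD (reverse_cycle c) = cA c"
        using that by (intro cD_reverse_cycle[of n]) (auto simp: two_run_cycles_def)
      then show ?thesis using that cA_add_cD[of c] by (simp add: two_run_cycles_def)
    qed
    then show ?thesis by (auto simp: two_run_cycles_def)
  qed
  moreover have "inj_on reverse_cycle (two_run_cycles n)"
    by (rule inj_on_subset[OF inj_on_reverse_cycle]) (auto simp: two_run_cycles_def)
  ultimately show ?thesis
    by (simp add: odd_cycles_2 card_Un_disjoint fin card_image)
qed

lemma reverse_increasing_not_increasing:
  "c \<in> increasing_cycles n \<Longrightarrow> reverse_cycle c \<notin> increasing_cycles n"
proof -
  assume c: "c \<in> increasing_cycles n"
  have "cD (reverse_cycle c) = cA c"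
    using c by (intro cD_reverse_cycle[of n]) (auto simp: increasing_cycles_def)
  then show ?thesis using c cA_add_cD[of c] by (auto simp: increasing_cycles_def)
qed

text \<open>Each of the two cycles may be reversed independently. Reversal keeps the entries and the
  head, so disjointness and the order of the pair survive, and two free bits give the factor
  4.\<close>

lemma card_cycle_pairs:
  "card (cycle_pairs (odd_cycles n 1)) = 4 * card (cycle_pairs (increasing_cycles n))"
proof -
  let ?I = "increasing_cycles n"
  let ?f = "\<lambda>(s, t, a, b). (if s then reverse_cycle a else a, if t then reverse_cycle b else b)"
  let ?D = "(UNIV :: bool set) \<times> (UNIV :: bool set) \<times> cycle_pairs ?I"
  have ne: "c \<noteq> []" if "c \<in> ?I" for c using that by (auto simp: increasing_cycles_def)
  have inj1: "s = s' \<and> a = a'"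
    if "a \<in> ?I" "a' \<in> ?I" "(if s then reverse_cycle a else a) = (if s' then reverse_cycle a' else a')"
    for s s' :: bool and a a'
    using that reverse_increasing_not_increasing ne reverse_cycle_simps(4) by (metis (full_types))
  have inj: "inj_on ?f ?D"
  proof (rule inj_onI)
    fix u v assume uv: "u \<in> ?D" "v \<in> ?D" "?f u = ?f v"
    obtain s t a b s' t' a' b' where u: "u = (s, t, a, b)" "v = (s', t', a', b')"
      by (metis surj_pair)
    have "s = s' \<and> a = a'" by (rule inj1) (use uv u in \<open>auto simp: cycle_pairs_def\<close>)
    moreover have "t = t' \<and> b = b'" by (rule inj1) (use uv u in \<open>auto simp: cycle_pairs_def\<close>)
    ultimately show "u = v" using u by simp
  qed
  have "?f ` ?D = cycle_pairs (odd_cycles n 1)"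
  proof
    show "?f ` ?D \<subseteq> cycle_pairs (odd_cycles n 1)"
    proof (rule image_subsetI)
      fix u assume u: "u \<in> ?D"
      obtain s t a b where u': "u = (s, t, a, b)" by (metis surj_pair)
      have ab: "a \<in> ?I" "b \<in> ?I" "set a \<inter> set b = {}" "hd a < hd b"
        using u u' by (auto simp: cycle_pairs_def)
      then have "{a, reverse_cycle a, b, reverse_cycle b} \<subseteq> odd_cycles n 1" unfolding odd_cycles_1 by blast
      then show "?f u \<in> cycle_pairs (odd_cycles n 1)"
        using ab ne[OF ab(1)] ne[OF ab(2)] by (simp add: u' cycle_pairs_def)
    qed
    show "cycle_pairs (odd_cycles n 1) \<subseteq> ?f ` ?D"
    proof
      fix u assume u: "u \<in> cycle_pairs (odd_cycles n 1)"
      then obtain c d where cd: "u = (c, d)" "c \<in> odd_cycles n 1" "d \<in> odd_cycles n 1"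
        "set c \<inter> set d = {}" "hd c < hd d" by (auto simp: cycle_pairs_def)
      have ex: "\<exists>s a. a \<in> ?I \<and> c = (if s then reverse_cycle a else a) \<and> set a = set c \<and> hd a = hd c"
        if c: "c \<in> odd_cycles n 1" for c
      proof -
        consider "c \<in> ?I" | a where "a \<in> ?I" "c = reverse_cycle a"
          using c unfolding odd_cycles_1 by blast
        then show ?thesis
        proof cases
          case 1
          then have "c \<in> ?I \<and> c = (if False then reverse_cycle c else c) \<and> set c = set c \<and> hd c = hd c" by simp
          then show ?thesis by blast
        next
          case 2
          then have "a \<in> ?I \<and> c = (if True then reverse_cycle a else a) \<and> set a = set c \<and> hd a = hd c"
            using ne by simp
          then show ?thesis by blast
        qed
      qed
      obtain s a where a: "a \<in> ?I" "c = (if s then reverse_cycle a else a)" "set a = set c" "hd a = hd c"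
        using ex[OF cd(2)] by blast
      obtain t b where b: "b \<in> ?I" "d = (if t then reverse_cycle b else b)" "set b = set d" "hd b = hd d"
        using ex[OF cd(3)] by blast
      have "(s, t, a, b) \<in> ?D" using a b cd by (simp add: cycle_pairs_def)
      moreover have "u = ?f (s, t, a, b)" using a(2) b(2) cd(1) by simp
      ultimately show "u \<in> ?f ` ?D" by (rule rev_image_eqI)
    qed
  qed
  then have "card (cycle_pairs (odd_cycles n 1)) = card ?D" using card_image[OF inj] by simp
  then show ?thesis by (simp add: card_cartesian_product)
qed

section \<open>Matching increasing runs and cycles with splittings\<close>

lemma sorted_cycle_head:
  assumes "sorted_wrt (<) (a :: nat list)" "x \<in> set a"
  shows "hd a \<le> x"
  using assms by (cases a) (auto simp: less_imp_le)

text \<open>Supplies the third list: the points outside the cycles, which the permutation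
  fixes.\<close>

lemma complement_split:
  assumes "sorted_wrt (<) a" "sorted_wrt (<) b" "distinct (a @ b)" "set (a @ b) \<subseteq> {1..n}"
  shows "(a, b, sorted_list_of_set ({1..n} - set (a @ b))) \<in> splits 1 n"
proof -
  have "set (a @ b @ sorted_list_of_set ({1..n} - set (a @ b))) = {1..<1 + n}"
    using assms(4) by auto
  then show ?thesis
    using assms unfolding splits_def by (auto simp: strict_sorted_list_of_set)
qed

lemma splits_third_unique:
  assumes "(a, b, c) \<in> splits m n" "(a, b, c') \<in> splits m n"
  shows "c = c'"
proof -
  have "set c = {m..<m + n} - set (a @ b)" if "(a, b, c) \<in> splits m n" for c
    using that unfolding splits_def by auto
  then have "set c = set c'" using assms by blast
  then show ?thesis using assms unfolding splits_def by (auto intro: strict_sorted_equal)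
qed

lemma card_two_run_cycles: "int (card (two_run_cycles n)) = count_splits one_cycle_split n"
proof -
  let ?S = "splits_with one_cycle_split 1 n"
  have S: "drops a b \<and> starts_below a b \<and> odd (length (a @ b)) \<and> 5 \<le> length (a @ b) \<and>
      sorted_wrt (<) a \<and> sorted_wrt (<) b \<and> distinct (a @ b) \<and> set (a @ b) \<subseteq> {1..n} \<and> (a, b, c) \<in> splits 1 n"
    if "(a, b, c) \<in> ?S" for a b c
  proof -
    have "set (a @ b) \<subseteq> {1..<1 + n}" using that unfolding splits_with_def splits_def by auto
    then show ?thesis
      using that unfolding splits_with_def splits_def one_cycle_split_def by (auto simp: less_Suc_eq_le)
  qed
  have "bij_betw (\<lambda>(a, b, c). a @ b) ?S (two_run_cycles n)"
  proof (rule bij_betw_imageI)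
    show "inj_on (\<lambda>(a, b, c). a @ b) ?S"
    proof (rule inj_onI)
      fix t t' assume tt': "t \<in> ?S" "t' \<in> ?S" "(\<lambda>(a, b, c). a @ b) t = (\<lambda>(a, b, c). a @ b) t'"
      obtain a b c a' b' c' where t: "t = (a, b, c)" "t' = (a', b', c')" by (metis surj_pair)
      note 1 = S[OF tt'(1)[unfolded t]] and 2 = S[OF tt'(2)[unfolded t]]
      have eq: "a @ b = a' @ b'" using tt' t by simp
      \<comment> \<open>The only descent marks the end of the first run, so \<open>a\<close> and
        \<open>b\<close> are recovered from \<open>a @ b\<close>.\<close>
      have "list_descents (a @ b) = {length a}" "list_descents (a' @ b') = {length a'}"
        using 1 2 list_descents_singleton_iff by blast+
      then have "length a = length a'" using eq by simp
      then have "a = a'" "b = b'" using eq by auto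
      then show "t = t'" using 1 2 splits_third_unique t by blast
    qed
    show "(\<lambda>(a, b, c). a @ b) ` ?S = two_run_cycles n"
    proof
      show "(\<lambda>(a, b, c). a @ b) ` ?S \<subseteq> two_run_cycles n"
      proof (rule image_subsetI)
        fix t assume t: "t \<in> ?S"
        obtain a b c where abc: "t = (a, b, c)" by (metis surj_pair)
        note 1 = S[OF t[unfolded abc]]
        have "hd (a @ b) \<le> y" if "y \<in> set (a @ b)" for y
        proof -
          have "a \<noteq> []" "hd a < hd b" using 1 by (auto simp: starts_below_def)
          moreover have "hd a \<le> y \<or> hd b \<le> y" using that 1 sorted_cycle_head by auto
          ultimately show ?thesis by auto
        qed
        moreover have "a @ b \<noteq> []" using 1 by (auto simp: drops_def)
        ultimately have "is_cycle n (a @ b)" using 1 by (simp add: is_cycle_def)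
        moreover have "list_descents (a @ b) = {length a}"
          using 1 list_descents_singleton_iff by blast
        ultimately have "a @ b \<in> two_run_cycles n"
          using 1 cD_eq_list_descents[of n "a @ b"] by (simp add: two_run_cycles_def)
        then show "(case t of (a, b, c) \<Rightarrow> a @ b) \<in> two_run_cycles n" using abc by simp
      qed
      show "two_run_cycles n \<subseteq> (\<lambda>(a, b, c). a @ b) ` ?S"
      proof
        fix e assume "e \<in> two_run_cycles n"
        then have e: "is_cycle n e" "odd (length e)" "5 \<le> length e" "cD e = 2" "distinct e" "set e \<subseteq> {1..n}"
          by (auto simp: two_run_cycles_def is_cycle_def)
        then have "card (list_descents e) = 1" using cD_eq_list_descents[of n e] by simp
        then obtain i where "list_descents e = {i}" by (rule card_1_singletonE)
        then obtain a b where ab: "e = a @ b" "drops a b" "sorted_wrt (<) a" "sorted_wrt (<) b"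
          using list_descents_singleton_iff[OF e(5)] by blast
        define c where "c = sorted_list_of_set ({1..n} - set (a @ b))"
        have "(a, b, c) \<in> splits 1 n"
          unfolding c_def by (rule complement_split) (use ab e in auto)
        moreover have "starts_below a b"
        proof -
          have ne: "a \<noteq> []" "b \<noteq> []" using ab by (auto simp: drops_def)
          then have "hd a \<le> hd b" using e(1) ab by (auto simp: is_cycle_def)
          moreover have "hd a \<noteq> hd b" using e(5) ab(1) hd_in_set[OF ne(1)] hd_in_set[OF ne(2)] by (metis disjoint_iff distinct_append)
          ultimately show ?thesis using ne by (simp add: starts_below_def)
        qed
        ultimately have "(a, b, c) \<in> ?S"
          using e ab by (simp add: splits_with_def one_cycle_split_def)
        then show "e \<in> (\<lambda>(a, b, c). a @ b) ` ?S" using ab by force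
      qed
    qed
  qed
  then have "card (two_run_cycles n) = card ?S" by (simp add: bij_betw_same_card)
  then show ?thesis by (simp only: card_splits_with)
qed

text \<open>With \<open>cD\<close> equal to 1, the return to the head is the only cyclic descent, so
  the list itself has none.\<close>

lemma increasing_cycles_iff:
  "c \<in> increasing_cycles n \<longleftrightarrow> sorted_wrt (<) c \<and> set c \<subseteq> {1..n} \<and> odd (length c) \<and> 3 \<le> length c"
proof
  assume "c \<in> increasing_cycles n"
  then have c: "is_cycle n c" "odd (length c)" "3 \<le> length c" "cD c = 1" by (auto simp: increasing_cycles_def)
  then have "list_descents c = {}" using cD_eq_list_descents[of n c] by simp
  then show "sorted_wrt (<) c \<and> set c \<subseteq> {1..n} \<and> odd (length c) \<and> 3 \<le> length c"
    using c list_descents_empty_iff[of c] by (auto simp: is_cycle_def)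
next
  assume c: "sorted_wrt (<) c \<and> set c \<subseteq> {1..n} \<and> odd (length c) \<and> 3 \<le> length c"
  then have "distinct c" by (auto simp: strict_sorted_iff)
  moreover have "c \<noteq> []" using c by auto
  ultimately have "is_cycle n c" using c sorted_cycle_head[of c] by (simp add: is_cycle_def)
  then show "c \<in> increasing_cycles n"
    using c cD_eq_list_descents[of n c] list_descents_empty_iff[OF \<open>distinct c\<close>]
    by (simp add: increasing_cycles_def)
qed

lemma card_increasing_cycle_pairs:
  "int (card (cycle_pairs (increasing_cycles n))) = count_splits two_cycle_split n"
proof -
  let ?S = "splits_with two_cycle_split 1 n"
  have "bij_betw (\<lambda>(a, b, c). (a, b)) ?S (cycle_pairs (increasing_cycles n))"
  proof (rule bij_betw_imageI)
    show "inj_on (\<lambda>(a, b, c). (a, b)) ?S"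
      by (rule inj_onI) (auto simp: splits_with_def dest: splits_third_unique)
    show "(\<lambda>(a, b, c). (a, b)) ` ?S = cycle_pairs (increasing_cycles n)"
    proof
      show "(\<lambda>(a, b, c). (a, b)) ` ?S \<subseteq> cycle_pairs (increasing_cycles n)"
      proof (rule image_subsetI)
        fix t assume t: "t \<in> ?S"
        obtain a b c where abc: "t = (a, b, c)" by (metis surj_pair)
        have "set a \<subseteq> {1..<1 + n}" "set b \<subseteq> {1..<1 + n}"
          using t unfolding abc splits_with_def splits_def by auto
        then have "set a \<subseteq> {1..n}" "set b \<subseteq> {1..n}" by auto
        then show "(case t of (a, b, c) \<Rightarrow> (a, b)) \<in> cycle_pairs (increasing_cycles n)"
          using t unfolding abc splits_with_def splits_def two_cycle_split_def
          by (auto simp: cycle_pairs_def increasing_cycles_iff starts_below_def)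
      qed
      show "cycle_pairs (increasing_cycles n) \<subseteq> (\<lambda>(a, b, c). (a, b)) ` ?S"
      proof
        fix u assume "u \<in> cycle_pairs (increasing_cycles n)"
        then obtain a b where u: "u = (a, b)" "a \<in> increasing_cycles n" "b \<in> increasing_cycles n"
          "set a \<inter> set b = {}" "hd a < hd b" by (auto simp: cycle_pairs_def)
        then have ab: "sorted_wrt (<) a" "sorted_wrt (<) b" "set (a @ b) \<subseteq> {1..n}" "distinct (a @ b)"
          "odd (length a)" "odd (length b)" "3 \<le> length a" "3 \<le> length b"
          by (auto simp: increasing_cycles_iff strict_sorted_iff)
        define c where "c = sorted_list_of_set ({1..n} - set (a @ b))"
        have "(a, b, c) \<in> splits 1 n"
          unfolding c_def by (rule complement_split[OF ab(1,2,4,3)])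
        moreover have "starts_below a b" using ab u(5) by (auto simp: starts_below_def)
        ultimately have "(a, b, c) \<in> ?S" using ab by (simp add: splits_with_def two_cycle_split_def)
        then show "u \<in> (\<lambda>(a, b, c). (a, b)) ` ?S" using u(1) by force
      qed
    qed
  qed
  then have "card (cycle_pairs (increasing_cycles n)) = card ?S" by (simp add: bij_betw_same_card)
  then show ?thesis by (simp only: card_splits_with)
qed

lemma odd_cycle_number_2_count:
  "int (odd_cycle_number n 2) =
     2 * count_splits one_cycle_split n + 4 * count_splits two_cycle_split n"
  unfolding odd_cycle_number_2 card_odd_cycles_2 card_cycle_pairs
  by (simp add: card_two_run_cycles card_increasing_cycle_pairs)

section \<open>Binomial coefficients and comparison of the closed forms\<close>

lemma choose_2_int: "2 * int (n choose 2) = int n * (int n - 1)"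
proof (induction n)
  case (Suc n)
  then show ?case by (simp add: numeral_2_eq_2 algebra_simps)
qed simp

lemma choose_3_int: "6 * int (n choose 3) = int n * (int n - 1) * (int n - 2)"
proof (induction n)
  case (Suc n)
  then show ?case
    using choose_2_int[of n] by (simp add: numeral_3_eq_3 numeral_2_eq_2 algebra_simps)
qed simp

theorem theorem1p4:
  fixes n :: nat
  assumes "n \<ge> 2"
  shows "ballot_number n 2 = odd_cycle_number n 2 \<and>
         int (odd_cycle_number n 2) =
           3 * int (eulerian (n - 1) 2) - 2 * int (n choose 3) + int (n choose 2) - 1"
proof -
  \<comment> \<open>The closed forms are stated from index 2 on, so everything is expressed in k = n
    - 2.\<close>
  obtain k where "n = 2 + k" using assms le_Suc_ex by blast
  then have n: "n = Suc (Suc k)" by simp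
  have b: "3 * int (ballot_number n 2) = 27 * 3 ^ k - 18 * (int k + 2) * 2 ^ k
      - int k ^ 3 + 3 * (int k)\<^sup>2 + 16 * int k + 9"
    unfolding n ballot_number_2 by (rule count_ballot_split)
  \<comment> \<open>Twice the one-cycle formula plus six times the two-cycle formula; their (-1)^k
    terms have coefficients -6 and 6.\<close>
  have p: "12 * int (odd_cycle_number n 2) = 108 * 3 ^ k - 72 * (int k + 2) * 2 ^ k
      - 4 * int k ^ 3 + 12 * (int k)\<^sup>2 + 64 * int k + 36"
    unfolding n odd_cycle_number_2_count
    using count_one_cycle_split[of k] count_two_cycle_split[of k]
    by (simp del: count_splits.simps add: algebra_simps power2_eq_square power3_eq_cube)
  have e: "2 * int (eulerian (n - 1) 2) = 6 * 3 ^ k - 4 * (int k + 2) * 2 ^ k + (int k + 1) * (int k + 2)"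
    using count_xy[of "Suc k"] by (simp del: count_splits.simps add: n eulerian_2 algebra_simps)
  have c2: "2 * int (n choose 2) = (int k + 2) * (int k + 1)"
    using choose_2_int[of n] by (simp add: n algebra_simps)
  have c3: "6 * int (n choose 3) = (int k + 2) * (int k + 1) * int k"
    using choose_3_int[of n] by (simp add: n algebra_simps)
  have "12 * int (ballot_number n 2) = 12 * int (odd_cycle_number n 2)"
    using b p by (simp add: algebra_simps)
  moreover have "6 * int (odd_cycle_number n 2) =
      6 * (3 * int (eulerian (n - 1) 2) - 2 * int (n choose 3) + int (n choose 2) - 1)"
    using p e c2 c3 by (simp add: algebra_simps power2_eq_square power3_eq_cube)
  ultimately show ?thesis by simp
qed

end
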